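(* For any color-critical graph $F$ with chromatic number $\chi(F)=r+1\geq 4$, there exists $n_0$ such that if $G$ is an $F$-free graph on $n\geq n_0$ vertices with $m$ edges, then \[ \sum_{v\in V(G)} d^2(v)\leq 2\left(1-\frac{1}{r}\right)mn, \] where the equality holds if and only if $G$ is a regular complete $r$-partite graph.
   Context: All graphs are finite and simple. $V(G)$ is the vertex set of $G$, $d(v)$ denotes the degree of the vertex $v$ in $G$, and $d^2(v)=(d(v))^2$. A graph $G$ is $F$-free if it contains no subgraph (not necessarily induced) isomorphic to $F$. A graph $F$ is color-critical if there is an edge $e$ of $F$ with $\chi(F-e)<\chi(F)$, where $F-e$ is obtained from $F$ by deleting the edge $e$ and $\chi$ denotes the chromatic number. A regular complete $r$-partite graph is a complete $r$-partite graph (with $r$ nonempty parts) all of whose vertices have the same degree, i.e. the parts all have equal size.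
   Formalization: The equality characterization is stated only for graphs with m > 0 edges: an edgeless graph gives equality 0 = 0 without being complete r-partite, so the printed "only if" fails there; the inequality itself is proved for all m. *)

theory Defs
  imports Complex_Main "HOL-Library.Disjoint_Sets"
begin

text \<open>A graph is a vertex set together with a set of edges; finiteness and simplicity
  (every edge is a 2-element set of vertices) are imposed by \<open>simple_graph\<close>.\<close>

type_synonym 'a graph = "'a set \<times> 'a set set"

abbreviation verts :: "'a graph \<Rightarrow> 'a set" where
  "verts G \<equiv> fst G"

abbreviation edges :: "'a graph \<Rightarrow> 'a set set" where
  "edges G \<equiv> snd G"

definition simple_graph :: "'a graph \<Rightarrow> bool" where
  "simple_graph G \<longleftrightarrow> finite (verts G) \<and> (\<forall>e\<in>edges G. e \<subseteq> verts G \<and> card e = 2)"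

definition degree :: "'a graph \<Rightarrow> 'a \<Rightarrow> nat" where
  "degree G v = card {e \<in> edges G. v \<in> e}"

definition subgraph :: "'a graph \<Rightarrow> 'a graph \<Rightarrow> bool" where
  "subgraph H G \<longleftrightarrow> simple_graph H \<and> verts H \<subseteq> verts G \<and> edges H \<subseteq> edges G"

definition isomorphic :: "'a graph \<Rightarrow> 'b graph \<Rightarrow> bool" where
  "isomorphic G H \<longleftrightarrow>
    (\<exists>f. bij_betw f (verts G) (verts H) \<and>
         (\<forall>u\<in>verts G. \<forall>v\<in>verts G. {u, v} \<in> edges G \<longleftrightarrow> {f u, f v} \<in> edges H))"

definition free_of :: "'a graph \<Rightarrow> 'b graph \<Rightarrow> bool" where
  "free_of F G \<longleftrightarrow> \<not> (\<exists>H. subgraph H G \<and> isomorphic F H)"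

definition proper_coloring :: "'a graph \<Rightarrow> nat \<Rightarrow> ('a \<Rightarrow> nat) \<Rightarrow> bool" where
  "proper_coloring G k c \<longleftrightarrow>
    (\<forall>v\<in>verts G. c v < k) \<and> (\<forall>u v. {u, v} \<in> edges G \<longrightarrow> c u \<noteq> c v)"

definition chromatic_number :: "'a graph \<Rightarrow> nat" where
  "chromatic_number G = (LEAST k. \<exists>c. proper_coloring G k c)"

definition delete_edge :: "'a graph \<Rightarrow> 'a set \<Rightarrow> 'a graph" where
  "delete_edge G e = (verts G, edges G - {e})"

definition color_critical :: "'a graph \<Rightarrow> bool" where
  "color_critical G \<longleftrightarrow>
    (\<exists>e\<in>edges G. chromatic_number (delete_edge G e) < chromatic_number G)"

text \<open>The classes of a \<open>partition_on\<close> are nonempty by definition.\<close>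

definition complete_multipartite :: "nat \<Rightarrow> 'a graph \<Rightarrow> bool" where
  "complete_multipartite r G \<longleftrightarrow>
    (\<exists>P. partition_on (verts G) P \<and> card P = r \<and>
         edges G = {{u, v} | u v. \<exists>A\<in>P. \<exists>B\<in>P. A \<noteq> B \<and> u \<in> A \<and> v \<in> B})"

definition regular :: "'a graph \<Rightarrow> bool" where
  "regular G \<longleftrightarrow> (\<forall>u\<in>verts G. \<forall>v\<in>verts G. degree G u = degree G v)"

end

theory Submission
  imports Defs
begin

text \<open>Write \<open>n\<close> for the number of vertices, \<open>m\<close> for the number of edges, \<open>d(v)\<close> for degrees, \<open>N(v)\<close> for
  neighbourhoods, and call the difference of the two sides of the inequality the excess.

  If \<open>G\<close> has no clique on \<open>r + 1\<close> vertices, the proof is short. Among the edges leaving a neighbour of \<open>v\<close>, those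
  that stay in \<open>N(v)\<close> number \<open>2 e(N(v))\<close> and at most \<open>d(v) (n - d(v))\<close> others exist. Summing over \<open>v\<close> gives
  \<open>2 \<Sum> d\<^sup>2 \<le> 2 m n + \<Sum> 2 e(N(v))\<close>. As \<open>N(v)\<close> contains no clique on \<open>r\<close> vertices, Turan's bound
  \<open>2 e(N(v)) \<le> (1 - 1 / (r - 1)) d(v)\<^sup>2\<close> applies, and the result rearranges to the claim. Equality forces both
  ends of each edge to see all vertices, so that \<open>G\<close> is complete multipartite, and forces every
  neighbourhood to be a Turan graph, so that for \<open>r \<ge> 3\<close> all classes have the same size
  (\<open>excess_nonpos_if_clique_free\<close>, \<open>extremal_structure\<close>).

  A color-critical graph of chromatic number \<open>r + 1\<close> is contained in a complete \<open>r\<close>-partite graph with large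
  classes plus one edge inside a class. So \<open>G\<close> contains no such graph, and in particular no \<open>N(v)\<close> contains a
  complete \<open>r\<close>-partite graph with large classes. By the Erdos-Stone theorem the bound on \<open>e(N(v))\<close> then holds up
  to \<open>\<epsilon> n\<^sup>2\<close>, which proves the inequality up to an error of order \<open>\<epsilon> n\<^sup>3\<close>. It becomes exact by vertex
  deletion. Suppose that the excess is nonnegative and that \<open>m > 0\<close>; then \<open>m\<close> is quadratic in \<open>n\<close>
  (\<open>arcs_large_if_excess_nonneg\<close>). Suppose also that no deletion of a vertex increases the excess by 1 or more.
  This local optimality says for each single vertex that
  \<open>2 (1 - 1 / r) m \<le> (r - 3) / (r - 1) d(v)\<^sup>2 + (2 / r) d(v) n\<close>, up to a small multiple of \<open>n\<^sup>2\<close>. Hence every degree is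
  almost as large as the average, so the degrees are concentrated, and a nonnegative excess is only possible if
  the average is almost \<open>(1 - 1 / r) n\<close> (\<open>min_degree_if_deletion_stable\<close>). With such a minimum degree, an edge
  with noticeably more than \<open>(1 - 2 / r) n\<close> common neighbours would produce the forbidden graph
  (\<open>codegree_less_if_no_plus_blowup\<close>), whereas a clique on \<open>r + 1\<close> vertices would contain such an edge
  (\<open>clique_free_if_codegrees_small\<close>). So the graph is clique-free and the first part applies.

  Consequently a large graph with positive excess has a vertex whose deletion increases the excess by 1, again
  and again until only boundedly many vertices are left. The excess of the last graph is bounded, so the
  number of deletions is too (\<open>excess_nonpos_if_no_plus_blowup\<close>). A large graph with excess 0
  admits no such deletion, hence is clique-free and falls under the equality case above.\<close>

section \<open>Degrees and neighbourhoods\<close>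

lemma pigeonhole_fibre:
  assumes "finite A" "card A > t * card (f ` A)"
  obtains y where "y \<in> f ` A" "card {x \<in> A. f x = y} > t"
proof -
  have "\<exists>y\<in>f ` A. card {x \<in> A. f x = y} > t"
  proof (rule ccontr)
    assume "\<not> (\<exists>y\<in>f ` A. card {x \<in> A. f x = y} > t)"
    then have "(\<Sum>y\<in>f ` A. card {x \<in> A. f x = y}) \<le> (\<Sum>y\<in>f ` A. t)"
      by (intro sum_mono) (auto simp: not_less)
    moreover have "card A \<le> (\<Sum>y\<in>f ` A. card {x \<in> A. f x = y})"
    proof -
      have "A = (\<Union>y\<in>f ` A. {x \<in> A. f x = y})" by auto
      then show ?thesis using card_UN_le[of "f ` A" "\<lambda>y. {x \<in> A. f x = y}"] assms(1) by simp
    qed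
    ultimately show False using assms(2) by (simp add: mult.commute)
  qed
  then show thesis using that by blast
qed

text \<open>A graph is handled as a symmetric irreflexive relation \<open>E\<close> on a type, and its induced subgraphs as
  finite sets \<open>V\<close> of vertices. Passing to a neighbourhood or deleting a vertex then only changes \<open>V\<close>.\<close>

locale adjacency =
  fixes E :: "'b \<Rightarrow> 'b \<Rightarrow> bool"
  assumes sym: "E x y \<Longrightarrow> E y x"
    and irrefl: "\<not> E x x"
begin

definition nbrs :: "'b set \<Rightarrow> 'b \<Rightarrow> 'b set" where
  "nbrs V v = {w \<in> V. E v w}"

definition deg :: "'b set \<Rightarrow> 'b \<Rightarrow> real" where
  "deg V v = real (card (nbrs V v))"

text \<open>Edges are counted with both orientations, so this is twice the number of edges in \<open>V\<close>.\<close>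

definition arcs :: "'b set \<Rightarrow> real" where
  "arcs V = (\<Sum>v\<in>V. deg V v)"

text \<open>The left-hand side minus the right-hand side of the inequality to be proved, with \<open>arcs V\<close> for \<open>2 m\<close>.\<close>

definition excess :: "nat \<Rightarrow> 'b set \<Rightarrow> real" where
  "excess r V = (\<Sum>v\<in>V. (deg V v)\<^sup>2) - (1 - 1 / real r) * arcs V * real (card V)"

lemma nbrs_subset: "nbrs V v \<subseteq> V"
  by (auto simp: nbrs_def)

lemma finite_nbrs: "finite V \<Longrightarrow> finite (nbrs V v)"
  using nbrs_subset finite_subset by blast

lemma deg_nonneg: "deg V v \<ge> 0"
  by (simp add: deg_def)

lemma deg_le_card: "finite V \<Longrightarrow> deg V v \<le> card V"
  unfolding deg_def using card_mono[OF _ nbrs_subset] by auto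

lemma arcs_nonneg: "arcs V \<ge> 0"
  by (simp add: arcs_def deg_nonneg sum_nonneg)

lemma arcs_le_card_sq: "finite V \<Longrightarrow> arcs V \<le> (card V)\<^sup>2"
  using sum_bounded_above[of V "deg V" "real (card V)"] deg_le_card[of V]
  by (simp add: arcs_def power2_eq_square)

lemma deg_eq_sum: "finite V \<Longrightarrow> deg V v = (\<Sum>w\<in>V. if E v w then 1 else 0)"
  by (simp add: deg_def nbrs_def sum.If_cases Int_def)

lemma deg_mono: "finite V \<Longrightarrow> U \<subseteq> V \<Longrightarrow> deg U v \<le> deg V v"
  unfolding deg_def nbrs_def by (intro of_nat_mono card_mono) auto

lemma arcs_mono:
  assumes "finite V" "U \<subseteq> V" shows "arcs U \<le> arcs V"
proof -
  have "arcs U \<le> (\<Sum>v\<in>U. deg V v)"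
    unfolding arcs_def by (intro sum_mono deg_mono assms)
  also have "\<dots> \<le> arcs V"
    unfolding arcs_def by (intro sum_mono2 assms deg_nonneg)
  finally show ?thesis .
qed

text \<open>The degree of \<open>u\<close> is counted once for every neighbour \<open>v\<close> of \<open>u\<close>.\<close>

lemma sum_nbrs_deg_eq_sum_deg_sq:
  assumes "finite V"
  shows "(\<Sum>v\<in>V. \<Sum>u\<in>nbrs V v. deg V u) = (\<Sum>v\<in>V. (deg V v)\<^sup>2)"
proof -
  have eq: "(\<Sum>u\<in>nbrs V v. deg V u) = (\<Sum>u\<in>V. if E v u then deg V u else 0)" for v
    unfolding nbrs_def using assms by (simp add: sum.inter_filter)
  have "(\<Sum>v\<in>V. \<Sum>u\<in>nbrs V v. deg V u) = (\<Sum>u\<in>V. \<Sum>v\<in>V. if E v u then deg V u else 0)"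
    unfolding eq by (rule sum.swap)
  also have "\<dots> = (\<Sum>u\<in>V. (deg V u)\<^sup>2)"
  proof (intro sum.cong refl)
    fix u assume "u \<in> V"
    have "(\<Sum>v\<in>V. if E v u then deg V u else 0) = (\<Sum>v\<in>V. (if E u v then 1 else 0) * deg V u)"
      by (intro sum.cong refl) (auto dest: sym)
    then show "(\<Sum>v\<in>V. if E v u then deg V u else 0) = (deg V u)\<^sup>2"
      by (simp add: sum_distrib_right[symmetric] deg_eq_sum[OF assms, symmetric] power2_eq_square)
  qed
  finally show ?thesis .
qed

text \<open>An edge leaving a neighbour of \<open>v\<close> ends either in the neighbourhood of \<open>v\<close> or outside it.\<close>

lemma sum_nbrs_deg_eq:
  assumes "finite V"
  shows "(\<Sum>u\<in>nbrs V v. deg V u)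
    = arcs (nbrs V v) + (\<Sum>u\<in>nbrs V v. real (card (nbrs (V - nbrs V v) u)))"
proof -
  have "deg V u = deg (nbrs V v) u + real (card (nbrs (V - nbrs V v) u))" for u
  proof -
    have "nbrs V u = nbrs (nbrs V v) u \<union> nbrs (V - nbrs V v) u"
      by (auto simp: nbrs_def)
    moreover have "nbrs (nbrs V v) u \<inter> nbrs (V - nbrs V v) u = {}"
      by (auto simp: nbrs_def)
    ultimately show ?thesis
      using card_Un_disjoint[of "nbrs (nbrs V v) u" "nbrs (V - nbrs V v) u"] assms
      by (simp add: deg_def finite_nbrs)
  qed
  then show ?thesis
    by (simp add: arcs_def sum.distrib)
qed

lemma card_non_nbrs:
  "finite V \<Longrightarrow> real (card (V - nbrs V v)) = real (card V) - deg V v"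
  by (simp add: deg_def nbrs_subset finite_nbrs card_Diff_subset card_mono of_nat_diff)

text \<open>Each neighbour of \<open>v\<close> has at most \<open>n - deg V v\<close> neighbours outside the neighbourhood of \<open>v\<close>.\<close>

lemma sum_nbrs_deg_le:
  assumes "finite V"
  shows "(\<Sum>u\<in>nbrs V v. deg V u) \<le> arcs (nbrs V v) + deg V v * (card V - deg V v)"
proof -
  have "(\<Sum>u\<in>nbrs V v. real (card (nbrs (V - nbrs V v) u)))
      \<le> (\<Sum>u\<in>nbrs V v. real (card (V - nbrs V v)))"
    using assms by (intro sum_mono of_nat_mono card_mono nbrs_subset) auto
  also have "\<dots> = deg V v * (card V - deg V v)"
    using card_non_nbrs[OF assms] by (simp add: deg_def)
  finally show ?thesis
    using sum_nbrs_deg_eq[OF assms] by simp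
qed

text \<open>The local bound, summed over all \<open>v\<close>. It reduces the sum of squared degrees to the number of edges
  inside neighbourhoods, that is, to the number of triangles.\<close>

lemma twice_sum_deg_sq_le:
  assumes "finite V"
  shows "2 * (\<Sum>v\<in>V. (deg V v)\<^sup>2) \<le> card V * arcs V + (\<Sum>v\<in>V. arcs (nbrs V v))"
proof -
  have "(\<Sum>v\<in>V. (deg V v)\<^sup>2) \<le> (\<Sum>v\<in>V. arcs (nbrs V v) + deg V v * (card V - deg V v))"
    unfolding sum_nbrs_deg_eq_sum_deg_sq[OF assms, symmetric]
    by (intro sum_mono sum_nbrs_deg_le assms)
  also have "\<dots> = (\<Sum>v\<in>V. arcs (nbrs V v)) + card V * arcs V - (\<Sum>v\<in>V. (deg V v)\<^sup>2)"
    by (simp add: algebra_simps sum.distrib sum_subtractf sum_distrib_left arcs_def power2_eq_square)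
  finally show ?thesis by simp
qed

text \<open>The Cauchy-Schwarz inequality, read off from the variance of the degrees.\<close>

lemma arcs_sq_le:
  assumes "finite V"
  shows "(arcs V)\<^sup>2 \<le> card V * (\<Sum>v\<in>V. (deg V v)\<^sup>2)"
proof (cases "card V = 0")
  case True
  then show ?thesis using assms by (simp add: arcs_def)
next
  case False
  let ?n = "real (card V)"
  have "0 \<le> (\<Sum>v\<in>V. (?n * deg V v - arcs V)\<^sup>2)"
    by (intro sum_nonneg) simp
  also have "\<dots> = (\<Sum>v\<in>V. ?n * ?n * (deg V v)\<^sup>2 - 2 * ?n * arcs V * deg V v + (arcs V)\<^sup>2)"
    by (intro sum.cong refl) (simp add: power2_eq_square algebra_simps)
  also have "\<dots> = ?n * ?n * (\<Sum>v\<in>V. (deg V v)\<^sup>2) - 2 * ?n * arcs V * arcs V + ?n * (arcs V)\<^sup>2"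
    by (simp add: sum.distrib sum_subtractf sum_distrib_left[symmetric] arcs_def[symmetric])
  also have "\<dots> = ?n * (?n * (\<Sum>v\<in>V. (deg V v)\<^sup>2) - (arcs V)\<^sup>2)"
    by (simp add: power2_eq_square algebra_simps)
  finally show ?thesis
    using False by (simp add: zero_le_mult_iff)
qed

section \<open>Clique-free graphs and sparse graphs\<close>

definition clique :: "'b set \<Rightarrow> bool" where
  "clique K \<longleftrightarrow> finite K \<and> (\<forall>x\<in>K. \<forall>y\<in>K. x \<noteq> y \<longrightarrow> E x y)"

definition clique_free :: "nat \<Rightarrow> 'b set \<Rightarrow> bool" where
  "clique_free k V \<longleftrightarrow> \<not> (\<exists>K\<subseteq>V. clique K \<and> card K = k)"

lemma clique_free_nbrs:
  assumes "clique_free (Suc k) V" "v \<in> V"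
  shows "clique_free k (nbrs V v)"
  unfolding clique_free_def
proof
  assume "\<exists>K\<subseteq>nbrs V v. clique K \<and> card K = k"
  then obtain K where K: "K \<subseteq> nbrs V v" "clique K" "card K = k" by blast
  have "v \<notin> K" using K(1) irrefl by (auto simp: nbrs_def)
  then have "clique (insert v K)" "card (insert v K) = Suc k" "insert v K \<subseteq> V"
    using K assms(2) sym by (auto simp: clique_def nbrs_def)
  then show False using assms(1) by (auto simp: clique_free_def)
qed

text \<open>If neighbourhoods have about the edge density allowed to graphs without a clique on \<open>k\<close> vertices,
  then inserting this into the previous bound and solving for the sum of squares produces the factor
  \<open>1 - 1 / k\<close>. The error \<open>e\<close> is 0 for clique-free graphs and \<open>\<epsilon> n\<^sup>2\<close> in the asymptotic argument.\<close>

lemma sum_deg_sq_le_if_nbrs_sparse: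
  fixes k :: nat
  assumes V: "finite V" and k: "k \<ge> 2"
    and nb: "\<And>v. v \<in> V \<Longrightarrow> arcs (nbrs V v) \<le> (1 - 1 / (real k - 1)) * (deg V v)\<^sup>2 + e"
  shows "(\<Sum>v\<in>V. (deg V v)\<^sup>2) \<le> (1 - 1 / real k) * (arcs V * card V + e * card V)"
proof -
  let ?Q = "\<Sum>v\<in>V. (deg V v)\<^sup>2"
  have "(\<Sum>v\<in>V. arcs (nbrs V v)) \<le> (\<Sum>v\<in>V. (1 - 1 / (real k - 1)) * (deg V v)\<^sup>2 + e)"
    by (intro sum_mono nb)
  also have "\<dots> = (1 - 1 / (real k - 1)) * ?Q + e * card V"
    by (simp add: sum.distrib sum_distrib_left)
  finally have "2 * ?Q \<le> card V * arcs V + (1 - 1 / (real k - 1)) * ?Q + e * card V"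
    using twice_sum_deg_sq_le[OF V] by linarith
  then have "?Q * (real k / (real k - 1)) \<le> card V * arcs V + e * card V"
    using k by (simp add: field_simps)
  then have "?Q * (real k / (real k - 1)) * (1 - 1 / real k)
      \<le> (card V * arcs V + e * card V) * (1 - 1 / real k)"
    using k by (intro mult_right_mono) auto
  moreover have "?Q * (real k / (real k - 1)) * (1 - 1 / real k) = ?Q"
    using k by (simp add: field_simps)
  ultimately show ?thesis by (simp add: algebra_simps)
qed

text \<open>Turan's density bound by induction on \<open>k\<close>: it holds in every neighbourhood, which bounds the sum of
  squared degrees, and Cauchy-Schwarz turns this into a bound on the number of edges.\<close>

lemma turan_density:
  assumes "finite V" "clique_free (Suc k) V" "k \<ge> 1"
  shows "arcs V \<le> (1 - 1 / real k) * (card V)\<^sup>2"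
  using assms(3,1,2)
proof (induction k arbitrary: V rule: dec_induct)
  case base
  have "nbrs V v = {}" if "v \<in> V" for v
  proof (rule ccontr)
    assume "nbrs V v \<noteq> {}"
    then obtain w where "w \<in> V" "E v w" by (auto simp: nbrs_def)
    moreover from this have "v \<noteq> w" using irrefl by auto
    ultimately have "clique {v, w}" "card {v, w} = 2" "{v, w} \<subseteq> V"
      using that sym by (auto simp: clique_def)
    then show False using base unfolding clique_free_def by (metis Suc_1)
  qed
  then show ?case by (simp add: arcs_def deg_def)
next
  case (step k)
  have "arcs (nbrs V v) \<le> (1 - 1 / (real (Suc k) - 1)) * (deg V v)\<^sup>2 + 0" if "v \<in> V" for v
    using step.IH[OF finite_nbrs clique_free_nbrs, OF step.prems that] by (simp add: deg_def)
  from sum_deg_sq_le_if_nbrs_sparse[OF step.prems(1) _ this] step.hyps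
  have *: "(\<Sum>v\<in>V. (deg V v)\<^sup>2) \<le> (1 - 1 / real (Suc k)) * (arcs V * card V)"
    by simp
  have "arcs V * arcs V \<le> card V * ((1 - 1 / real (Suc k)) * (arcs V * card V))"
    using arcs_sq_le[OF step.prems(1)] mult_left_mono[OF *, of "real (card V)"]
    by (simp add: power2_eq_square)
  then have "arcs V * arcs V \<le> arcs V * ((1 - 1 / real (Suc k)) * (card V)\<^sup>2)"
    by (simp add: power2_eq_square mult_ac)
  moreover have "(1 - 1 / real (Suc k)) * (card V)\<^sup>2 \<ge> 0"
    by (intro mult_nonneg_nonneg) auto
  ultimately show ?case
    using arcs_nonneg[of V] by (cases "arcs V = 0") (auto simp: mult_le_cancel_left)
qed

lemma clique_free_arcs_nbrs:
  assumes "finite V" "clique_free (Suc r) V" "r \<ge> 2" "v \<in> V"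
  shows "arcs (nbrs V v) \<le> (1 - 1 / (real r - 1)) * (deg V v)\<^sup>2"
proof -
  obtain k where k: "r = Suc k" using assms(3) by (cases r) auto
  show ?thesis
    using turan_density[OF finite_nbrs clique_free_nbrs, OF assms(1) assms(2)[unfolded k] assms(4)]
      assms(3) by (simp add: k deg_def)
qed

lemma excess_nonpos_if_clique_free:
  assumes "finite V" "clique_free (Suc r) V" "r \<ge> 2"
  shows "excess r V \<le> 0"
proof -
  have "arcs (nbrs V v) \<le> (1 - 1 / (real r - 1)) * (deg V v)\<^sup>2 + 0" if "v \<in> V" for v
    using clique_free_arcs_nbrs[OF assms that] by simp
  from sum_deg_sq_le_if_nbrs_sparse[OF assms(1,3) this] show ?thesis
    by (simp add: excess_def algebra_simps)
qed

text \<open>In a sparse graph the inequality is strict because there are few triangles. A neighbourhood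
  spans at most \<open>min (arcs V) (d\<^sup>2) \<le> d * sqrt (arcs V)\<close> arcs, so the sum of squares is at most
  \<open>arcs V * (n + sqrt (arcs V)) / 2\<close>; since \<open>1 - 1 / r \<ge> 2 / 3\<close>, a nonnegative excess needs
  \<open>sqrt (arcs V) \<ge> n / 3\<close>. For \<open>r = 2\<close> stars would be an obstruction.\<close>

lemma arcs_large_if_excess_nonneg:
  assumes V: "finite V" and r: "r \<ge> 3" and ex: "excess r V \<ge> 0" and pos: "arcs V > 0"
  shows "arcs V \<ge> (card V)\<^sup>2 / 9"
proof -
  let ?n = "real (card V)"
  let ?Q = "\<Sum>v\<in>V. (deg V v)\<^sup>2"
  have nb: "arcs (nbrs V v) \<le> deg V v * sqrt (arcs V)" for v
  proof -
    have a: "arcs (nbrs V v) \<le> arcs V"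
      by (intro arcs_mono V nbrs_subset)
    have b: "arcs (nbrs V v) \<le> (deg V v)\<^sup>2"
      using arcs_le_card_sq[OF finite_nbrs[OF V]] by (simp add: deg_def)
    have "(arcs (nbrs V v))\<^sup>2 \<le> (deg V v)\<^sup>2 * arcs V"
      unfolding power2_eq_square[of "arcs (nbrs V v)"]
      by (intro mult_mono a b) (auto simp: arcs_nonneg)
    also have "\<dots> = (deg V v * sqrt (arcs V))\<^sup>2"
      using pos by (simp add: power_mult_distrib)
    finally show ?thesis
      by (rule power2_le_imp_le) (simp add: arcs_nonneg deg_nonneg)
  qed
  have "2 * ?Q \<le> ?n * arcs V + (\<Sum>v\<in>V. deg V v * sqrt (arcs V))"
    using twice_sum_deg_sq_le[OF V] sum_mono[of V, OF nb] by (meson add_left_mono order_trans)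
  then have "2 * ?Q \<le> arcs V * (?n + sqrt (arcs V))"
    by (simp add: sum_distrib_right[symmetric] arcs_def algebra_simps)
  moreover have "?Q \<ge> (2/3) * arcs V * ?n"
  proof -
    have "(2/3) * arcs V * ?n \<le> (1 - 1 / real r) * arcs V * ?n"
      using r pos by (intro mult_right_mono) (auto simp: field_simps)
    also have "\<dots> \<le> ?Q" using ex by (simp add: excess_def)
    finally show ?thesis .
  qed
  ultimately have "arcs V * ((4/3) * ?n) \<le> arcs V * (?n + sqrt (arcs V))" by simp
  then have "(4/3) * ?n \<le> ?n + sqrt (arcs V)" using pos by simp
  then have "?n / 3 \<le> sqrt (arcs V)" by simp
  then have "(?n / 3)\<^sup>2 \<le> (sqrt (arcs V))\<^sup>2" by (intro power_mono) auto
  then show ?thesis using pos by (simp add: power_divide)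
qed

section \<open>Deleting a vertex\<close>

lemma nbrs_delete:
  assumes "v \<in> V" shows "nbrs V u = (if E u v then insert v (nbrs (V - {v}) u) else nbrs (V - {v}) u)"
  using assms by (auto simp: nbrs_def)

lemma deg_delete:
  assumes "finite V" "v \<in> V"
  shows "deg (V - {v}) u = deg V u - (if E v u then 1 else 0)"
proof -
  have "v \<notin> nbrs (V - {v}) u" by (auto simp: nbrs_def)
  moreover have "E u v \<longleftrightarrow> E v u" using sym by blast
  ultimately show ?thesis
    using finite_nbrs[of "V - {v}" u] assms(1) by (simp add: deg_def nbrs_delete[OF assms(2), of u])
qed

lemma sum_delete_indicator:
  assumes "finite V"
  shows "(\<Sum>u\<in>V-{v}. if E v u then (g u :: real) else 0) = (\<Sum>u\<in>nbrs V v. g u)"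
proof -
  have "nbrs V v = {u \<in> V - {v}. E v u}" using irrefl by (auto simp: nbrs_def)
  then show ?thesis using sum.inter_filter[of "V - {v}" g "E v"] assms by (simp only: finite_Diff)
qed

lemma arcs_delete:
  assumes "finite V" "v \<in> V"
  shows "arcs (V - {v}) = arcs V - 2 * deg V v"
proof -
  have "arcs (V - {v}) = (\<Sum>u\<in>V-{v}. deg V u) - (\<Sum>u\<in>V-{v}. if E v u then 1 else 0)"
    unfolding arcs_def by (simp add: deg_delete[OF assms] sum_subtractf)
  also have "(\<Sum>u\<in>V-{v}. if E v u then 1 else (0::real)) = deg V v"
    by (subst sum_delete_indicator[OF assms(1)]) (simp add: deg_def)
  also have "(\<Sum>u\<in>V-{v}. deg V u) = arcs V - deg V v"
    using assms by (simp add: arcs_def sum_diff1)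
  finally show ?thesis by simp
qed

lemma excess_delete:
  assumes "finite V" "v \<in> V"
  shows "excess r (V - {v}) = excess r V - (deg V v)\<^sup>2 - 2 * (\<Sum>u\<in>nbrs V v. deg V u) + deg V v
    + (1 - 1 / real r) * (arcs V + 2 * deg V v * (real (card V) - 1))"
proof -
  have "(\<Sum>u\<in>V-{v}. (deg (V - {v}) u)\<^sup>2)
      = (\<Sum>u\<in>V-{v}. (deg V u)\<^sup>2 - (if E v u then 2 * deg V u - 1 else 0))"
    unfolding deg_delete[OF assms] by (intro sum.cong refl) (auto simp: power2_diff)
  also have "\<dots> = (\<Sum>u\<in>V. (deg V u)\<^sup>2) - (deg V v)\<^sup>2 - (\<Sum>u\<in>nbrs V v. 2 * deg V u - 1)"
    unfolding sum_subtractf sum_delete_indicator[OF assms(1)]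
    using assms by (simp add: sum_diff1)
  also have "(\<Sum>u\<in>nbrs V v. 2 * deg V u - 1) = 2 * (\<Sum>u\<in>nbrs V v. deg V u) - deg V v"
    by (simp add: sum_subtractf sum_distrib_left[symmetric] deg_def)
  finally have sq: "(\<Sum>u\<in>V-{v}. (deg (V - {v}) u)\<^sup>2) = (\<Sum>u\<in>V. (deg V u)\<^sup>2) - (deg V v)\<^sup>2
      - (2 * (\<Sum>u\<in>nbrs V v. deg V u) - deg V v)" .
  have "card V > 0" using assms card_gt_0_iff by blast
  then have c: "real (card (V - {v})) = real (card V) - 1"
    using assms by (simp add: of_nat_diff)
  have "Q - q - (2 * S - d) - \<alpha> * (a - 2 * d) * (n - 1)
      = Q - \<alpha> * a * n - q - 2 * S + d + \<alpha> * (a + 2 * d * (n - 1))" for Q q S d \<alpha> a n :: real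
    by (simp add: algebra_simps)
  then show ?thesis
    unfolding excess_def sq arcs_delete[OF assms] c by blast
qed

section \<open>The Erdos-Stone theorem\<close>

lemma sum_deg_swap:
  assumes "finite A" "finite V"
  shows "(\<Sum>w\<in>V. deg A w) = (\<Sum>x\<in>A. deg V x)"
proof -
  have "(\<Sum>w\<in>V. deg A w) = (\<Sum>x\<in>A. \<Sum>w\<in>V. if E w x then 1 else 0)"
    unfolding deg_eq_sum[OF assms(1)] by (rule sum.swap)
  also have "\<dots> = (\<Sum>x\<in>A. deg V x)"
    unfolding deg_eq_sum[OF assms(2)] by (intro sum.cong refl) (auto dest: sym)
  finally show ?thesis .
qed

definition joined :: "'b set \<Rightarrow> 'b set \<Rightarrow> bool" where
  "joined A B \<longleftrightarrow> (\<forall>x\<in>A. \<forall>y\<in>B. E x y)"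

text \<open>The sets \<open>B 0, \<dots>, B (k - 1)\<close> are the classes of a complete \<open>k\<close>-partite subgraph with \<open>t\<close> vertices in each
  class. The subgraph need not be induced. Distinct classes are disjoint because \<open>E\<close> is irreflexive.\<close>

definition multipartite :: "nat \<Rightarrow> nat \<Rightarrow> 'b set \<Rightarrow> (nat \<Rightarrow> 'b set) \<Rightarrow> bool" where
  "multipartite k t V B \<longleftrightarrow> (\<forall>i<k. B i \<subseteq> V \<and> finite (B i) \<and> card (B i) = t) \<and>
    (\<forall>i<k. \<forall>j<k. i \<noteq> j \<longrightarrow> joined (B i) (B j))"

text \<open>Let \<open>Q\<close> be the union of \<open>k\<close> large classes of size \<open>T\<close>. The degree condition makes the average number of
  neighbours in \<open>Q\<close> exceed \<open>(k - 1) * T + t\<close>, so a constant proportion of all vertices have at least \<open>t\<close>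
  neighbours in every class. There are only \<open>2 ^ (k * T)\<close> possible neighbourhoods in \<open>Q\<close>, hence \<open>t\<close> of
  these vertices have the same one. They form a new class over \<open>t\<close> vertices of each old class. The set \<open>X\<close>
  of two vertices is kept out of the new class because later an extra edge has to be added there.\<close>

lemma extend_multipartite:
  assumes V: "finite V" and B: "multipartite k T V B" and k: "k \<ge> 1"
    and deg: "\<And>v. v \<in> V \<Longrightarrow> deg V v \<ge> ((real k - 1) / real k + e) * card V"
    and T: "e * real T \<ge> real t + 1"
    and X: "finite X" "card X \<le> 2"
    and large: "card V > k * T * (t * 2 ^ (k * T) + 2)"
  obtains W B' where "W \<subseteq> V - X" "finite W" "card W = t" "multipartite k t V B'"
    "\<And>i. i < k \<Longrightarrow> B' i \<subseteq> B i" "\<And>i. i < k \<Longrightarrow> joined W (B' i)"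
proof -
  let ?n = "real (card V)"
  \<comment> \<open>The sum of \<open>a w\<close> over all \<open>w\<close> is computed in two ways: by degrees of vertices of \<open>Q\<close>, and by
    splitting the vertices \<open>w\<close> into those in \<open>G\<close> and the others.\<close>
  define Q where "Q = (\<Union>i<k. B i)"
  define a where "a w = (\<Sum>i<k. deg (B i) w)" for w
  have Bi: "B i \<subseteq> V" "finite (B i)" "card (B i) = T" if "i < k" for i
    using B that by (auto simp: multipartite_def)
  have degB: "deg (B i) w \<le> T" if "i < k" for i w
    using deg_le_card[of "B i" w] Bi[OF that] by simp
  have a_le: "a w \<le> real k * T" for w
    using sum_mono[of "{..<k}" "\<lambda>i. deg (B i) w" "\<lambda>_. real T"] degB by (simp add: a_def)
  define G where "G = {w \<in> V. a w \<ge> (real k - 1) * T + t}"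
  have G: "finite G" "G \<subseteq> V" using V by (auto simp: G_def)
  have "real k * T * (((real k - 1) / real k + e) * ?n) \<le> (\<Sum>w\<in>V. a w)"
  proof -
    have "(\<Sum>w\<in>V. a w) = (\<Sum>i<k. \<Sum>w\<in>V. deg (B i) w)"
      unfolding a_def by (rule sum.swap)
    also have "\<dots> = (\<Sum>i<k. \<Sum>x\<in>B i. deg V x)"
      using Bi V by (intro sum.cong refl sum_deg_swap) auto
    also have "\<dots> \<ge> (\<Sum>i<k. real T * (((real k - 1) / real k + e) * ?n))"
    proof (rule sum_mono)
      fix i assume "i \<in> {..<k}"
      then have i: "i < k" by simp
      have "(\<Sum>x\<in>B i. ((real k - 1) / real k + e) * ?n) \<le> (\<Sum>x\<in>B i. deg V x)"
        using Bi[OF i] by (intro sum_mono deg) auto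
      then show "real T * (((real k - 1) / real k + e) * ?n) \<le> (\<Sum>x\<in>B i. deg V x)"
        using Bi[OF i] by simp
    qed
    finally show ?thesis by (simp add: mult.assoc)
  qed
  moreover have "(\<Sum>w\<in>V. a w) \<le> card G * (real k * T) + ?n * ((real k - 1) * T + t)"
  proof -
    have "(\<Sum>w\<in>V. a w) \<le> (\<Sum>w\<in>V. (if w \<in> G then real k * T else 0) + ((real k - 1) * T + t))"
    proof (rule sum_mono)
      fix w assume "w \<in> V"
      have "(real k - 1) * T + t \<ge> 0" using k by (intro add_nonneg_nonneg mult_nonneg_nonneg) auto
      then show "a w \<le> (if w \<in> G then real k * T else 0) + ((real k - 1) * T + t)"
        using a_le[of w] \<open>w \<in> V\<close> by (auto simp: G_def)
    qed
    also have "\<dots> = (\<Sum>w\<in>V. if w \<in> G then real k * T else 0) + ?n * ((real k - 1) * T + t)"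
      by (simp add: sum.distrib)
    also have "(\<Sum>w\<in>V. if w \<in> G then real k * T else 0) = card G * (real k * T)"
      using V G(2) by (simp add: sum.If_cases Int_absorb1)
    finally show ?thesis .
  qed
  ultimately have "real k * T * (((real k - 1) / real k + e) * ?n)
      \<le> card G * (real k * T) + ?n * ((real k - 1) * T + t)" by linarith
  moreover have "real k * T * (((real k - 1) / real k + e) * ?n)
      = ?n * ((real k - 1) * T) + ?n * (real k * (e * T))"
    using k by (simp add: field_simps)
  moreover have "?n * (real k * (e * T)) \<ge> ?n * (real t + 1)"
  proof -
    have "1 * (e * T) \<le> real k * (e * T)"
      using k T by (intro mult_right_mono) auto
    then show ?thesis using T by (intro mult_left_mono) auto
  qed
  ultimately have "?n \<le> card G * (real k * T)" by (simp add: algebra_simps)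
  then have "real (card V) \<le> real (card G * (k * T))" by simp
  then have "card V \<le> card G * (k * T)" by (simp only: of_nat_le_iff)
  with large have "(k * T) * (t * 2 ^ (k * T) + 2) < (k * T) * card G"
    by (simp only: mult.commute[of "card G"])
  then have cG: "card G > t * 2 ^ (k * T) + 2" by (simp only: mult_less_cancel1)
  \<comment> \<open>Vertices of \<open>G - X\<close> are classified by their neighbourhood in \<open>Q\<close>.\<close>
  define A where "A = G - X"
  have "card A \<ge> card G - card X" unfolding A_def by (rule diff_card_le_card_Diff[OF X(1)])
  with cG X(2) have cA: "card A > t * 2 ^ (k * T)" by linarith
  have "card Q \<le> k * T"
    using card_UN_le[of "{..<k}" B] Bi by (simp add: Q_def)
  have Qf: "finite Q" using Bi by (auto simp: Q_def)
  have "card (nbrs Q ` A) \<le> card (Pow Q)"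
    using Qf nbrs_subset by (intro card_mono) auto
  also have "\<dots> \<le> 2 ^ (k * T)"
    using \<open>card Q \<le> k * T\<close> Qf by (simp add: card_Pow)
  finally have "t * card (nbrs Q ` A) \<le> t * 2 ^ (k * T)" by simp
  with cA obtain Z where Z: "card {w \<in> A. nbrs Q w = Z} > t"
    using pigeonhole_fibre[of A t "nbrs Q"] G(1) by (metis A_def finite_Diff le_less_trans)
  then obtain W where W: "W \<subseteq> {w \<in> A. nbrs Q w = Z}" "card W = t" "finite W"
    using obtain_subset_with_card_n[of t "{w \<in> A. nbrs Q w = Z}"] by auto
  from Z obtain w0 where w0: "w0 \<in> A" "nbrs Q w0 = Z"
    using card_gt_0_iff[of "{w \<in> A. nbrs Q w = Z}"] by fastforce
  have "\<exists>C. C \<subseteq> nbrs (B i) w0 \<and> card C = t" if i: "i < k" for i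
  proof -
    have "a w0 = deg (B i) w0 + (\<Sum>j\<in>{..<k} - {i}. deg (B j) w0)"
      unfolding a_def using i by (intro sum.remove) auto
    also have "(\<Sum>j\<in>{..<k} - {i}. deg (B j) w0) \<le> (\<Sum>j\<in>{..<k} - {i}. real T)"
      by (intro sum_mono degB) auto
    also have "\<dots> = (real k - 1) * T" using i by (simp add: of_nat_diff)
    finally have "deg (B i) w0 \<ge> t" using w0(1) by (simp add: A_def G_def)
    then show ?thesis using obtain_subset_with_card_n[of t "nbrs (B i) w0"]
      by (metis deg_def of_nat_le_iff)
  qed
  then obtain B' where B': "\<And>i. i < k \<Longrightarrow> B' i \<subseteq> nbrs (B i) w0" "\<And>i. i < k \<Longrightarrow> card (B' i) = t"
    by metis
  have sub: "B' i \<subseteq> B i" if "i < k" for i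
    using B'(1)[OF that] nbrs_subset by blast
  show thesis
  proof
    show "W \<subseteq> V - X" using W(1) G(2) by (auto simp: A_def)
    show "multipartite k t V B'"
      using B B' sub unfolding multipartite_def joined_def
      by (meson finite_subset order_trans subsetD)
    show "joined W (B' i)" if i: "i < k" for i
      unfolding joined_def
    proof (intro ballI)
      fix w x assume "w \<in> W" "x \<in> B' i"
      then have "x \<in> nbrs Q w0" using B'(1)[OF i] i by (auto simp: nbrs_def Q_def)
      then have "x \<in> nbrs Q w" using W(1) \<open>w \<in> W\<close> w0 by auto
      then show "E w x" by (simp add: nbrs_def)
    qed
  qed (use W sub in auto)
qed

lemma multipartite_mono:
  "multipartite k t U B \<Longrightarrow> U \<subseteq> V \<Longrightarrow> multipartite k t V B"
  unfolding multipartite_def by blast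

lemma multipartite_snoc:
  assumes "multipartite k t V B" "W \<subseteq> V" "finite W" "card W = t" "\<And>i. i < k \<Longrightarrow> joined W (B i)"
  shows "multipartite (Suc k) t V (B(k := W))"
proof -
  have "joined (B i) W" if "i < k" for i
    using assms(5)[OF that] sym by (auto simp: joined_def)
  then show ?thesis
    using assms by (auto simp: multipartite_def less_Suc_eq)
qed

text \<open>A vertex set maximising \<open>arcs U - \<beta> |U| (|U| + 1)\<close> has large minimum degree, since deleting a vertex of
  degree below \<open>\<beta> |U|\<close> would increase this quantity. The value at the maximum also shows that \<open>U\<close> is large.\<close>

lemma min_degree_subgraph:
  fixes \<beta> c :: real
  assumes V: "finite V" and \<beta>: "\<beta> \<ge> 0" and d: "arcs V \<ge> \<beta> * card V * (real (card V) + 1) + c"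
  obtains U where "U \<subseteq> V" "\<And>u. u \<in> U \<Longrightarrow> deg U u \<ge> \<beta> * card U" "(card U)\<^sup>2 \<ge> c"
proof -
  define h where "h U = arcs U - \<beta> * card U * (real (card U) + 1)" for U
  have fin: "finite (h ` Pow V)" "h ` Pow V \<noteq> {}" using V by auto
  obtain U where U: "U \<subseteq> V" "h U = Max (h ` Pow V)"
    using Max_in[OF fin] by auto
  have max: "h U' \<le> h U" if "U' \<subseteq> V" for U'
    using U(2) Max_ge[OF fin(1)] that by simp
  have Uf: "finite U" using U V finite_subset by blast
  show thesis
  proof
    show "U \<subseteq> V" by fact
    fix u assume u: "u \<in> U"
    then have "card U > 0" using Uf card_gt_0_iff by blast
    then have c: "real (card (U - {u})) = real (card U) - 1"
      using Uf u by (simp add: of_nat_diff)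
    have "h (U - {u}) \<le> h U" using U(1) by (intro max) auto
    then show "deg U u \<ge> \<beta> * card U"
      unfolding h_def arcs_delete[OF Uf u] c by (simp add: algebra_simps)
  next
    have "c \<le> h V" using d by (simp add: h_def)
    also have "\<dots> \<le> h U" by (rule max) simp
    also have "\<dots> \<le> arcs U" using \<beta> by (simp add: h_def)
    also have "\<dots> \<le> (card U)\<^sup>2" by (rule arcs_le_card_sq[OF Uf])
    finally show "c \<le> (card U)\<^sup>2" .
  qed
qed

end

text \<open>Induction on the number of classes. A subgraph of large minimum degree still has the density needed for
  \<open>k\<close> classes, which the induction hypothesis supplies with size \<open>T\<close> much larger than \<open>t\<close>, and the minimum
  degree yields one more class. The threshold \<open>N\<close> has to be the same for all graphs, so the relation \<open>E\<close> is
  quantified inside. For \<open>k = 0\<close> the quotient \<open>(k - 1) / k\<close> is 0 by the convention on division, and a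
  single class of \<open>t\<close> vertices exists in any graph with \<open>t\<close> vertices.\<close>

lemma erdos_stone:
  fixes e :: real
  assumes "e > 0"
  shows "\<exists>N. \<forall>(E :: 'b \<Rightarrow> 'b \<Rightarrow> bool) V. adjacency E \<longrightarrow> finite V \<longrightarrow> card V \<ge> N \<longrightarrow>
    adjacency.arcs E V \<ge> ((real k - 1) / real k + e) * (card V)\<^sup>2 \<longrightarrow>
    (\<exists>B. adjacency.multipartite E (Suc k) t V B)"
  using assms
proof (induction k arbitrary: t e)
  case 0
  have "\<exists>B. adjacency.multipartite E (Suc 0) t V B"
    if E: "adjacency E" and "finite V" "card V \<ge> t" for E :: "'b \<Rightarrow> 'b \<Rightarrow> bool" and V
  proof -
    interpret adjacency E by (rule E)
    obtain C where "C \<subseteq> V" "card C = t" "finite C"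
      using obtain_subset_with_card_n \<open>card V \<ge> t\<close> by metis
    then have "multipartite (Suc 0) t V (\<lambda>_. C)" by (simp add: multipartite_def)
    then show ?thesis by blast
  qed
  then show ?case by blast
next
  case (Suc k)
  define \<beta> where "\<beta> = real k / (real k + 1) + e / 2"
  have \<beta>: "\<beta> \<ge> 0" "\<beta> \<ge> (real k - 1) / real k + e / 2"
    using Suc.prems by (cases "k = 0"; simp add: \<beta>_def field_simps)+
  define T where "T = nat \<lceil>(real t + 1) / (e / 2)\<rceil>"
  have "(real t + 1) / (e / 2) \<le> T"
    unfolding T_def by (rule real_nat_ceiling_ge)
  then have T: "e / 2 * T \<ge> real t + 1"
    using Suc.prems by (simp add: field_simps)
  have "e / 2 > 0" using Suc.prems by simp
  then obtain N1 where N1_all: "\<forall>(E :: 'b \<Rightarrow> 'b \<Rightarrow> bool) V. adjacency E \<longrightarrow> finite V \<longrightarrow> card V \<ge> N1 \<longrightarrow>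
      adjacency.arcs E V \<ge> ((real k - 1) / real k + e / 2) * (card V)\<^sup>2 \<longrightarrow>
      (\<exists>B. adjacency.multipartite E (Suc k) T V B)"
    by (rule exE[OF Suc.IH[of "e / 2" T]])
  note N1 = N1_all[rule_format]
  define M where "M = max N1 (Suc (Suc k * T * (t * 2 ^ (Suc k * T) + 2)))"
  \<comment> \<open>The factor \<open>c\<close> satisfies \<open>c\<^sup>2 \<ge> 4 / e\<close>: a graph with at least \<open>M * c\<close> vertices has a subgraph of
    large minimum degree with at least \<open>M\<close> vertices.\<close>
  define c where "c = Suc (nat \<lceil>4 / e\<rceil>)"
  define N where "N = max (nat \<lceil>4 * \<beta> / e\<rceil>) (M * c)"
  have \<beta>_eq: "(real (Suc k) - 1) / real (Suc k) + e = \<beta> + e / 2"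
    by (simp add: \<beta>_def add.commute)
  have c: "real c \<ge> 4 / e" "c \<ge> 1" unfolding c_def by linarith+
  show ?case
  proof (intro exI[of _ N] allI impI)
    fix E :: "'b \<Rightarrow> 'b \<Rightarrow> bool" and V
    assume E: "adjacency E" and V: "finite V" and n: "card V \<ge> N"
      and a: "adjacency.arcs E V \<ge> ((real (Suc k) - 1) / real (Suc k) + e) * (card V)\<^sup>2"
    interpret adjacency E by (rule E)
    let ?n = "real (card V)"
    have n1: "?n \<ge> 4 * \<beta> / e" using n by (simp add: N_def)
    then have "e * ?n * ?n \<ge> 4 * \<beta> * ?n"
      using Suc.prems by (intro mult_right_mono) (auto simp: field_simps)
    moreover have "arcs V \<ge> (\<beta> + e / 2) * (?n * ?n)"
      using a unfolding \<beta>_eq by (simp add: power2_eq_square)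
    ultimately have "arcs V \<ge> \<beta> * ?n * (?n + 1) + e / 4 * ?n\<^sup>2"
      by (simp add: algebra_simps power2_eq_square)
    with V \<beta>(1) obtain U where U: "U \<subseteq> V" "\<And>u. u \<in> U \<Longrightarrow> deg U u \<ge> \<beta> * card U"
      "(card U)\<^sup>2 \<ge> e / 4 * ?n\<^sup>2"
      using min_degree_subgraph[of V \<beta> "e / 4 * ?n\<^sup>2"] by auto
    have Uf: "finite U" using U V finite_subset by blast
    have "M \<le> card U"
    proof -
      have "M * c \<le> card V" using n by (simp add: N_def)
      then have "real (M * c) \<le> ?n" by (simp only: of_nat_le_iff)
      then have "(real (M * c))\<^sup>2 \<le> ?n\<^sup>2" by (intro power_mono) auto
      then have "e / 4 * (real (M * c))\<^sup>2 \<le> e / 4 * ?n\<^sup>2"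
        using Suc.prems by (intro mult_left_mono) auto
      also have "\<dots> \<le> (real (card U))\<^sup>2" using U(3) by simp
      finally have "(e / 4 * (real c)\<^sup>2) * (real M)\<^sup>2 \<le> (real (card U))\<^sup>2"
        by (simp add: power_mult_distrib mult_ac)
      moreover have "1 \<le> e / 4 * (real c)\<^sup>2"
      proof -
        have "4 / e \<le> real c * 1" using c by simp
        also have "\<dots> \<le> real c * real c" using c by (intro mult_left_mono) auto
        finally show ?thesis using Suc.prems by (simp add: field_simps power2_eq_square)
      qed
      then have "1 * (real M)\<^sup>2 \<le> (e / 4 * (real c)\<^sup>2) * (real M)\<^sup>2"
        by (intro mult_right_mono) auto
      ultimately have "(real M)\<^sup>2 \<le> (real (card U))\<^sup>2" by linarith
      then have "real M \<le> real (card U)" by (rule power2_le_imp_le) simp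
      then show ?thesis by simp
    qed
    have aU: "arcs U \<ge> ((real k - 1) / real k + e / 2) * (card U)\<^sup>2"
    proof -
      have "((real k - 1) / real k + e / 2) * (card U)\<^sup>2 \<le> \<beta> * (card U)\<^sup>2"
        using \<beta> by (intro mult_right_mono) auto
      also have "\<dots> = (\<Sum>u\<in>U. \<beta> * card U)" by (simp add: power2_eq_square)
      also have "\<dots> \<le> arcs U" unfolding arcs_def by (intro sum_mono U)
      finally show ?thesis .
    qed
    have "card U \<ge> N1" using \<open>M \<le> card U\<close> by (simp add: M_def)
    from N1[OF E Uf this aU] obtain B where B: "multipartite (Suc k) T U B" by blast
    have dU: "deg U u \<ge> ((real (Suc k) - 1) / real (Suc k) + e / 2) * card U" if "u \<in> U" for u
      using U(2)[OF that] by (simp add: \<beta>_def add.commute)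
    have large: "card U > Suc k * T * (t * 2 ^ (Suc k * T) + 2)"
      using \<open>M \<le> card U\<close> by (simp only: M_def max.bounded_iff Suc_le_eq)
    have "1 \<le> Suc k" "card {} \<le> 2" by simp_all
    then obtain W B' where "W \<subseteq> U - {}" "finite W" "card W = t" "multipartite (Suc k) t U B'"
      "\<And>i. i < Suc k \<Longrightarrow> B' i \<subseteq> B i" "\<And>i. i < Suc k \<Longrightarrow> joined W (B' i)"
      using extend_multipartite[OF Uf B _ dU T finite.emptyI _ large] by blast
    then have "multipartite (Suc (Suc k)) t U (B'(Suc k := W))"
      by (intro multipartite_snoc) auto
    then show "\<exists>B. multipartite (Suc (Suc k)) t V B"
      using multipartite_mono U(1) by blast
  qed
qed

context adjacency
begin

section \<open>Edges with many common neighbours\<close>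

text \<open>A complete \<open>(k + 1)\<close>-partite graph with \<open>k\<close> classes \<open>B i\<close> and a last class \<open>W \<union> {x, y}\<close>, together with the edge
  \<open>x y\<close> inside the last class. With \<open>k + 1 = r\<close> and \<open>t\<close> large it contains every color-critical graph of
  chromatic number \<open>r + 1\<close> on \<open>t\<close> vertices. The set
  \<open>W\<close> alone has \<open>t\<close> vertices, which leaves room for a whole color class next to the extra edge.\<close>

definition plus_blowup :: "nat \<Rightarrow> nat \<Rightarrow> 'b set \<Rightarrow> bool" where
  "plus_blowup k t V \<longleftrightarrow> (\<exists>x y W B. x \<in> V \<and> y \<in> V \<and> E x y \<and>
    W \<subseteq> V - {x, y} \<and> finite W \<and> card W = t \<and> multipartite k t V B \<and>
    (\<forall>i<k. joined W (B i) \<and> joined {x, y} (B i)))"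

lemma plus_blowup_mono:
  assumes "plus_blowup k t U" "U \<subseteq> V"
  shows "plus_blowup k t V"
proof -
  obtain x y W B where "x \<in> U" "y \<in> U" "E x y" "W \<subseteq> U - {x, y}" "finite W" "card W = t"
    "multipartite k t U B" "\<forall>i<k. joined W (B i) \<and> joined {x, y} (B i)"
    using assms(1) unfolding plus_blowup_def by blast
  moreover from this assms(2) have "x \<in> V" "y \<in> V" "W \<subseteq> V - {x, y}" "multipartite k t V B"
    by (auto intro: multipartite_mono)
  ultimately show ?thesis unfolding plus_blowup_def by blast
qed

text \<open>The vertex \<open>v\<close> joins the last class: every vertex of that class is a neighbour of \<open>v\<close>, and one of them
  serves as the other end of the extra edge.\<close>

lemma plus_blowup_if_multipartite_nbrs:
  assumes V: "finite V" and v: "v \<in> V" and B: "multipartite (Suc k) (Suc t) (nbrs V v) B"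
  shows "plus_blowup k t V"
proof -
  have Bi: "B i \<subseteq> nbrs V v" "finite (B i)" "card (B i) = Suc t" if "i < Suc k" for i
    using B that by (auto simp: multipartite_def)
  have Bj: "joined (B i) (B j)" if "i < Suc k" "j < Suc k" "i \<noteq> j" for i j
    using B that by (auto simp: multipartite_def)
  have "\<exists>C. C \<subseteq> B i \<and> card C = t" if "i < k" for i
    using obtain_subset_with_card_n[of t "B i"] Bi(3)[of i] that by auto
  then obtain C where C: "\<And>i. i < k \<Longrightarrow> C i \<subseteq> B i" "\<And>i. i < k \<Longrightarrow> card (C i) = t"
    by metis
  obtain y where y: "y \<in> B k" using Bi(3)[of k] by fastforce
  have yv: "y \<in> V" "E v y" using y Bi(1)[of k] by (auto simp: nbrs_def)
  have "v \<notin> B k" using Bi(1)[of k] irrefl by (auto simp: nbrs_def)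
  have "B k - {y} \<subseteq> V - {v, y}" using Bi(1)[of k] \<open>v \<notin> B k\<close> by (auto simp: nbrs_def)
  moreover have "card (B k - {y}) = t" "finite (B k - {y})" using y Bi(2,3)[of k] by auto
  moreover have "multipartite k t V C"
    unfolding multipartite_def
  proof (intro conjI allI impI)
    fix i assume i: "i < k"
    then show "C i \<subseteq> V" "finite (C i)" "card (C i) = t"
      using C[OF i] Bi[of i] finite_subset nbrs_subset[of V v] by auto
    fix j assume j: "j < k" "i \<noteq> j"
    then show "joined (C i) (C j)"
      using Bj[of i j] i C(1)[OF i] C(1)[OF j(1)] unfolding joined_def by auto
  qed
  moreover have "joined (B k - {y}) (C i) \<and> joined {v, y} (C i)" if i: "i < k" for i
  proof -
    have "joined (B k) (C i)"
      using Bj[of k i] i C(1)[OF i] by (auto simp: joined_def)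
    moreover have "joined {v} (C i)"
      using Bi(1)[of i] i C(1)[OF i] unfolding joined_def nbrs_def by auto
    ultimately show ?thesis using y by (auto simp: joined_def)
  qed
  ultimately show ?thesis
    unfolding plus_blowup_def using v yv by blast
qed

lemma deg_le_deg_subset:
  assumes "finite V" "U \<subseteq> V"
  shows "deg V z \<le> deg U z + (real (card V) - real (card U))"
proof -
  have "nbrs V z \<subseteq> nbrs U z \<union> (V - U)" by (auto simp: nbrs_def)
  moreover have fin: "finite U" using assms finite_subset by blast
  ultimately have "card (nbrs V z) \<le> card (nbrs U z) + card (V - U)"
    using card_mono[of "nbrs U z \<union> (V - U)" "nbrs V z"] card_Un_le[of "nbrs U z" "V - U"]
      finite_nbrs[OF fin, of z] assms(1) by (meson finite_Diff finite_UnI order_trans)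
  moreover have "real (card (V - U)) = real (card V) - real (card U)"
    using assms fin by (simp add: card_Diff_subset card_mono of_nat_diff)
  ultimately show ?thesis by (simp add: deg_def)
qed

text \<open>This says that a set of \<open>w\<close> vertices, each missing at most \<open>(1 / r + \<delta>) n\<close> others, has relative minimum
  degree above \<open>1 - 1 / (r - 2)\<close> as soon as \<open>w\<close> exceeds \<open>(1 - 2 / r) n\<close> noticeably. The choice of \<open>\<delta>\<close> makes
  \<open>2 \<delta> n = c n / r\<close>.\<close>

lemma codegree_bound_numeric:
  fixes r c \<delta> n w :: real
  assumes r: "r \<ge> 3" and c: "c > 0" and \<delta>: "\<delta> = c / (2 * r)"
    and w: "w \<ge> (1 - 2 / r + c) * n" "w \<le> n" and n: "n \<ge> 0"
  shows "w - (1 / r + \<delta>) * n \<ge> ((r - 3) / (r - 2) + \<delta>) * w"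
proof -
  have "\<delta> > 0" using c r by (simp add: \<delta>)
  have "(1 - 2 / r + c) * n * (1 / (r - 2)) \<le> w * (1 / (r - 2))"
    using w r by (intro mult_right_mono) auto
  moreover have "(1 - 2 / r + c) * n * (1 / (r - 2)) = n / r + c / (r - 2) * n"
    using r by (simp add: field_simps)
  moreover have "c / r * n \<le> c / (r - 2) * n"
    using r c n by (intro mult_right_mono divide_left_mono) auto
  moreover have "c / r * n = \<delta> * n + \<delta> * n" by (simp add: \<delta>)
  moreover have "\<delta> * w \<le> \<delta> * n" using w \<open>\<delta> > 0\<close> by simp
  moreover have "((r - 3) / (r - 2) + \<delta>) * w = w - w * (1 / (r - 2)) + \<delta> * w"
    using r by (simp add: field_simps)
  moreover have "(1 / r + \<delta>) * n = n / r + \<delta> * n" by (simp add: distrib_right)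
  ultimately show ?thesis by linarith
qed

end

text \<open>In a graph whose minimum degree is almost \<open>(1 - 1 / r) n\<close>, let \<open>x y\<close> be an edge with noticeably more than
  \<open>(1 - 2 / r) n\<close> common neighbours. By Erdos-Stone the common neighbourhood contains a complete
  \<open>(r - 1)\<close>-partite graph with large classes; the minimum degree in the whole graph extends it by one more
  class, and \<open>x\<close>, \<open>y\<close> can be put into that class because they see all other classes.\<close>

lemma codegree_less_if_no_plus_blowup:
  fixes r t :: nat and c \<delta> :: real
  assumes r: "r \<ge> 3" and c: "c > 0" "c \<le> 1 / r" and \<delta>: "\<delta> = c / (2 * real r)"
  shows "\<exists>N. \<forall>(E :: 'b \<Rightarrow> 'b \<Rightarrow> bool) V. adjacency E \<longrightarrow> finite V \<longrightarrow> card V \<ge> N \<longrightarrow>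
    \<not> adjacency.plus_blowup E (r - 1) t V \<longrightarrow>
    (\<forall>v\<in>V. adjacency.deg E V v \<ge> (1 - 1 / real r - \<delta>) * card V) \<longrightarrow>
    (\<forall>x\<in>V. \<forall>y\<in>V. E x y \<longrightarrow>
      adjacency.deg E (adjacency.nbrs E V x) y < (1 - 2 / real r + c) * card V)"
proof -
  define e where "e = 1 / (2 * real r * real r)"
  have e: "e > 0" using r by (simp add: e_def)
  have \<delta>0: "\<delta> > 0" using c r by (simp add: \<delta>)
  have "c * r \<le> 1" using c r by (simp add: field_simps)
  then have \<delta>e: "\<delta> \<le> e" using r by (simp add: \<delta> e_def field_simps)
  define T where "T = nat \<lceil>(real t + 1) / e\<rceil>"
  have "(real t + 1) / e \<le> T" unfolding T_def by (rule real_nat_ceiling_ge)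
  then have T: "e * T \<ge> real t + 1" using e by (simp add: field_simps)
  obtain N1 where N1_all: "\<forall>(E :: 'b \<Rightarrow> 'b \<Rightarrow> bool) V. adjacency E \<longrightarrow> finite V \<longrightarrow> card V \<ge> N1 \<longrightarrow>
      adjacency.arcs E V \<ge> ((real (r - 2) - 1) / real (r - 2) + \<delta>) * (card V)\<^sup>2 \<longrightarrow>
      (\<exists>B. adjacency.multipartite E (Suc (r - 2)) T V B)"
    by (rule exE[OF erdos_stone[OF \<delta>0, of "r - 2" T]])
  note N1 = N1_all[rule_format]
  define k where "k = r - 1"
  have k: "Suc (r - 2) = k" "k \<ge> 1" "real k = real r - 1" using r by (auto simp: k_def of_nat_diff)
  have r2: "(real (r - 2) - 1) / real (r - 2) = (real r - 3) / (real r - 2)"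
    using r by (simp add: of_nat_diff)
  define N where "N = max (3 * N1) (Suc (k * T * (t * 2 ^ (k * T) + 2)))"
  show ?thesis
  proof (intro exI[of _ N] allI impI ballI)
    fix E :: "'b \<Rightarrow> 'b \<Rightarrow> bool" and V x y
    assume E: "adjacency E" and V: "finite V" and n: "card V \<ge> N"
      and no: "\<not> adjacency.plus_blowup E (r - 1) t V"
      and dV: "\<forall>v\<in>V. adjacency.deg E V v \<ge> (1 - 1 / real r - \<delta>) * card V"
      and xy: "x \<in> V" "y \<in> V" "E x y"
    interpret adjacency E by (rule E)
    let ?n = "real (card V)"
    show "deg (nbrs V x) y < (1 - 2 / real r + c) * ?n"
    proof (rule ccontr)
      define U where "U = nbrs (nbrs V x) y"
      have UV: "U \<subseteq> V" by (auto simp: U_def nbrs_def)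
      then have Uf: "finite U" using V finite_subset by blast
      assume "\<not> deg (nbrs V x) y < (1 - 2 / real r + c) * ?n"
      then have U: "real (card U) \<ge> (1 - 2 / real r + c) * ?n"
        by (simp add: deg_def U_def)
      have Un: "real (card U) \<le> ?n" using UV V by (simp add: card_mono)
      have dU: "deg U z \<ge> ((real r - 3) / (real r - 2) + \<delta>) * card U" if "z \<in> U" for z
      proof -
        have "deg V z \<ge> (1 - 1 / real r - \<delta>) * ?n" using dV UV that by blast
        then have "deg U z \<ge> card U - (1 / real r + \<delta>) * ?n"
          using deg_le_deg_subset[OF V UV, of z] by (simp add: algebra_simps)
        moreover have "card U - (1 / real r + \<delta>) * ?n \<ge> ((real r - 3) / (real r - 2) + \<delta>) * card U"
          using r c(1) \<delta> U Un by (intro codegree_bound_numeric[of _ c]) auto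
        ultimately show ?thesis by linarith
      qed
      have "(\<Sum>z\<in>U. ((real r - 3) / (real r - 2) + \<delta>) * card U) \<le> arcs U"
        unfolding arcs_def by (intro sum_mono dU)
      then have "arcs U \<ge> ((real (r - 2) - 1) / real (r - 2) + \<delta>) * (card U)\<^sup>2"
        unfolding r2 by (simp add: power2_eq_square mult_ac)
      moreover have "card U \<ge> N1"
      proof -
        have "2 / real r \<le> 2 / 3" using r by (simp add: field_simps)
        then have "(1 / 3) * ?n \<le> (1 - 2 / real r + c) * ?n"
          using c by (intro mult_right_mono) auto
        then have "3 * real (card U) \<ge> ?n" using U by simp
        then show ?thesis using n by (simp add: N_def)
      qed
      ultimately obtain B where B: "multipartite k T U B"
        using N1[OF E Uf] k(1) by auto
      have dVk: "deg V v \<ge> ((real k - 1) / real k + e) * ?n" if "v \<in> V" for v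
      proof -
        have "(real k - 1) / real k + e \<le> 1 - 1 / real r - \<delta>"
        proof -
          have "1 / (real r - 1) - 1 / real r = 1 / (real r * (real r - 1))"
            using r by (simp add: field_simps)
          moreover have "1 / (real r * (real r - 1)) \<ge> 1 / (real r * real r)"
            using r by (intro divide_left_mono) auto
          moreover have "2 * e = 1 / (real r * real r)" by (simp add: e_def)
          moreover have "(real k - 1) / real k = 1 - 1 / (real r - 1)"
            using r k by (simp add: field_simps)
          ultimately show ?thesis using \<delta>e by linarith
        qed
        then have "((real k - 1) / real k + e) * ?n \<le> (1 - 1 / real r - \<delta>) * ?n"
          by (intro mult_right_mono) auto
        then show ?thesis using dV[rule_format, OF that] by linarith
      qed
      have large: "card V > k * T * (t * 2 ^ (k * T) + 2)" using n by (simp add: N_def)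
      have card_xy: "card {x, y} \<le> 2" by (simp add: card_insert_if)
      obtain W B' where W: "W \<subseteq> V - {x, y}" "finite W" "card W = t" "multipartite k t V B'"
        "\<And>i. i < k \<Longrightarrow> B' i \<subseteq> B i" "\<And>i. i < k \<Longrightarrow> joined W (B' i)"
        using extend_multipartite[OF V multipartite_mono[OF B UV] k(2) dVk T _ card_xy large] by blast
      have "joined {x, y} (B' i)" if "i < k" for i
      proof -
        have "B' i \<subseteq> U" using W(5)[OF that] B that by (auto simp: multipartite_def)
        then show ?thesis by (auto simp: joined_def U_def nbrs_def)
      qed
      with W(6) have "\<forall>i<k. joined W (B' i) \<and> joined {x, y} (B' i)" by blast
      with xy W(1-4) have "plus_blowup k t V"
        unfolding plus_blowup_def by blast
      then show False using no by (simp add: k_def)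
    qed
  qed
qed

context adjacency
begin

text \<open>Suppose that \<open>K\<close> is a clique on \<open>r + 1\<close> vertices and let \<open>j\<close> be the number of neighbours of a vertex in \<open>K\<close>.
  The average of \<open>j\<close> is about \<open>r - 1 / r\<close> by the minimum degree. As \<open>j\<close> is an integer,
  \<open>(j - r) (j - r + 1) \<ge> 0\<close>, so the average of \<open>j (j - 1)\<close> is at least
  \<open>2 (r - 1) (r - 1 / r) - r (r - 1)\<close>, which is larger by \<open>2 / r\<close> than the value \<open>(r + 1) (r - 2)\<close> that the
  bound on the numbers of common neighbours allows.\<close>

lemma clique_free_if_codegrees_small:
  fixes r :: nat and c \<delta> :: real
  assumes V: "finite V" "V \<noteq> {}" and r: "r \<ge> 3"
    and d: "\<And>v. v \<in> V \<Longrightarrow> deg V v \<ge> (1 - 1 / real r - \<delta>) * card V"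
    and cod: "\<And>x y. x \<in> V \<Longrightarrow> y \<in> V \<Longrightarrow> E x y \<Longrightarrow> deg (nbrs V x) y \<le> (1 - 2 / real r + c) * card V"
    and small: "(real r + 1) * real r * c + 2 * (real r - 1) * (real r + 1) * \<delta> < 2 / real r"
  shows "clique_free (Suc r) V"
  unfolding clique_free_def
proof
  assume "\<exists>K\<subseteq>V. clique K \<and> card K = Suc r"
  then obtain K where K: "K \<subseteq> V" "clique K" "card K = Suc r" by blast
  then have Kf: "finite K" by (simp add: clique_def)
  let ?n = "real (card V)"
  have n: "?n > 0" using V by (simp add: card_gt_0_iff)
  define D where "D = 1 - 1 / real r - \<delta>"
  define Q where "Q = 1 - 2 / real r + c"
  let ?J = "\<Sum>w\<in>V. deg K w"
  have J: "?J = (\<Sum>x\<in>K. deg V x)" by (rule sum_deg_swap[OF Kf V(1)])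
  have "(\<Sum>x\<in>K. D * ?n) \<le> (\<Sum>x\<in>K. deg V x)"
    using K(1) unfolding D_def by (intro sum_mono d) auto
  then have J_ge: "?J \<ge> (real r + 1) * (D * ?n)"
    unfolding J using K(3) by (simp add: add.commute)
  have codeg: "deg (nbrs V x) y = (\<Sum>w\<in>V. if E w x \<and> E w y then 1 else 0)" for x y
  proof -
    have "nbrs (nbrs V x) y = {w \<in> V. E w x \<and> E w y}"
      using sym by (auto simp: nbrs_def)
    then show ?thesis using V(1) by (simp add: deg_def sum.If_cases Int_def)
  qed
  have "(\<Sum>w\<in>V. (deg K w)\<^sup>2) = (\<Sum>w\<in>V. \<Sum>x\<in>K. \<Sum>y\<in>K. if E w x \<and> E w y then 1 else 0)"
    unfolding deg_eq_sum[OF Kf] power2_eq_square sum_product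
    by (intro sum.cong refl) auto
  also have "\<dots> = (\<Sum>x\<in>K. \<Sum>w\<in>V. \<Sum>y\<in>K. if E w x \<and> E w y then 1 else 0)"
    by (rule sum.swap)
  also have "\<dots> = (\<Sum>x\<in>K. \<Sum>y\<in>K. deg (nbrs V x) y)"
    unfolding codeg by (intro sum.cong refl sum.swap)
  also have "\<dots> \<le> (\<Sum>x\<in>K. deg V x + real r * (Q * ?n))"
  proof (rule sum_mono)
    fix x assume x: "x \<in> K"
    have "nbrs (nbrs V x) x = nbrs V x" by (auto simp: nbrs_def)
    then have "(\<Sum>y\<in>K. deg (nbrs V x) y) = deg V x + (\<Sum>y\<in>K-{x}. deg (nbrs V x) y)"
      using sum.remove[OF Kf x, of "deg (nbrs V x)"] by (simp add: deg_def)
    also have "(\<Sum>y\<in>K-{x}. deg (nbrs V x) y) \<le> (\<Sum>y\<in>K-{x}. Q * ?n)"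
      unfolding Q_def using K x by (intro sum_mono cod) (auto simp: clique_def)
    also have "\<dots> = real r * (Q * ?n)"
      using K(3) Kf x by simp
    finally show "(\<Sum>y\<in>K. deg (nbrs V x) y) \<le> deg V x + real r * (Q * ?n)"
      by simp
  qed
  also have "\<dots> = ?J + (real r + 1) * (real r * (Q * ?n))"
    using K(3) by (simp add: sum.distrib J add.commute)
  finally have sq: "(\<Sum>w\<in>V. (deg K w)\<^sup>2)
    \<le> ?J + (real r + 1) * (real r * (Q * ?n))" .
  have "(\<Sum>w\<in>V. (2 * real r - 1) * deg K w - real r * (real r - 1)) \<le> (\<Sum>w\<in>V. (deg K w)\<^sup>2)"
  proof (rule sum_mono)
    fix w
    define j where "j = int (card (nbrs K w))"
    have "(j - int r) * (j - int r + 1) \<ge> 0"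
      by (cases "j \<ge> int r") (auto intro: mult_nonneg_nonneg mult_nonpos_nonpos)
    then have "real_of_int ((j - int r) * (j - int r + 1)) \<ge> 0" by linarith
    moreover have "deg K w = real_of_int j" by (simp add: deg_def j_def)
    ultimately show "(2 * real r - 1) * deg K w - real r * (real r - 1) \<le> (deg K w)\<^sup>2"
      by (simp add: power2_eq_square algebra_simps)
  qed
  then have "(2 * real r - 1) * ?J - ?n * (real r * (real r - 1)) \<le> (\<Sum>w\<in>V. (deg K w)\<^sup>2)"
    by (simp add: sum_subtractf sum_distrib_left)
  with sq have "(2 * real r - 2) * ?J
      \<le> ?n * (real r * (real r - 1)) + (real r + 1) * (real r * (Q * ?n))"
    by (simp add: algebra_simps)
  moreover have "(2 * real r - 2) * ((real r + 1) * (D * ?n)) \<le> (2 * real r - 2) * ?J"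
    using r by (intro mult_left_mono J_ge) auto
  ultimately have "((2 * real r - 2) * (real r + 1) * D) * ?n
      \<le> (real r * (real r - 1) + (real r + 1) * (real r * Q)) * ?n"
    by (simp add: algebra_simps)
  then have "(2 * real r - 2) * (real r + 1) * D
      \<le> real r * (real r - 1) + (real r + 1) * (real r * Q)"
    using n by (simp only: mult_le_cancel_right)
  moreover have "(2 * real r - 2) * (real r + 1) * D
      = 2 * (real r)\<^sup>2 - 2 * real r - 2 + 2 / real r - 2 * (real r - 1) * (real r + 1) * \<delta>"
    using r by (simp add: D_def Q_def field_simps power2_eq_square)
  moreover have "real r * (real r - 1) + (real r + 1) * (real r * Q)
      = 2 * (real r)\<^sup>2 - 2 * real r - 2 + (real r + 1) * real r * c"
    using r by (simp add: D_def Q_def field_simps power2_eq_square)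
  ultimately show False using small by linarith
qed

end

section \<open>Graphs in which no deletion increases the excess\<close>

text \<open>With \<open>x\<close> a relative degree and \<open>\<mu>\<close> the relative average degree, this turns the local condition into a lower
  bound for all degrees. Up to multiples of \<open>\<epsilon>\<close> one may assume \<open>x \<le> \<mu> \<le> 1 - 1 / r\<close>. Then the right-hand side of \<open>local\<close> is at
  most \<open>(1 - 1 / r) x\<close>, because \<open>(r - 3) / (r - 1) * (1 - 1 / r) + 2 / r = 1 - 1 / r\<close>.\<close>

lemma degree_near_mean_numeric:
  fixes x \<mu> \<epsilon> r :: real
  assumes r: "r \<ge> 3" and x: "0 \<le> x" "x \<le> 1" and \<epsilon>: "\<epsilon> > 0" and \<mu>: "\<mu> \<ge> 0"
    and upper: "\<mu>\<^sup>2 \<le> (1 - 1 / r) * (\<mu> + \<epsilon>)"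
    and local: "(1 - 1 / r) * \<mu> \<le> (r - 3) / (r - 1) * x\<^sup>2 + 2 / r * x + 3 * \<epsilon>"
  shows "x \<ge> \<mu> - 7 * \<epsilon>"
proof (rule ccontr)
  assume "\<not> x \<ge> \<mu> - 7 * \<epsilon>"
  then have less: "x < \<mu> - 7 * \<epsilon>" by simp
  define \<alpha> where "\<alpha> = 1 - 1 / r"
  have \<alpha>: "\<alpha> \<ge> 2 / 3" "\<alpha> \<le> 1" using r by (auto simp: \<alpha>_def field_simps)
  have "\<mu> \<le> \<alpha> + 3 / 2 * \<epsilon>"
  proof (rule ccontr)
    assume "\<not> \<mu> \<le> \<alpha> + 3 / 2 * \<epsilon>"
    then have gt: "\<mu> > \<alpha> + 3 / 2 * \<epsilon>" by simp
    have "2 / 3 * (\<mu> - \<alpha>) \<le> \<mu> * (\<mu> - \<alpha>)"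
      using gt \<alpha> \<epsilon> by (intro mult_right_mono) auto
    also have "\<dots> \<le> \<alpha> * \<epsilon>"
      using upper by (simp add: \<alpha>_def[symmetric] power2_eq_square algebra_simps)
    also have "\<dots> \<le> 1 * \<epsilon>" using \<alpha> \<epsilon> by (intro mult_right_mono) auto
    finally show False using gt by simp
  qed
  then have x\<alpha>: "x \<le> \<alpha> + 3 / 2 * \<epsilon>" using less \<epsilon> by linarith
  have "(r - 3) / (r - 1) * x\<^sup>2 \<le> ((r - 3) / (r - 1) * (\<alpha> + 3 / 2 * \<epsilon>)) * x"
    unfolding power2_eq_square mult.assoc using x x\<alpha> r
    by (intro mult_left_mono mult_right_mono) auto
  also have "(r - 3) / (r - 1) * (\<alpha> + 3 / 2 * \<epsilon>) \<le> (r - 3) / r + 3 / 2 * \<epsilon>"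
  proof -
    have "(r - 3) / (r - 1) * (3 / 2 * \<epsilon>) \<le> 1 * (3 / 2 * \<epsilon>)"
      using r \<epsilon> by (intro mult_right_mono) auto
    moreover have "(r - 3) / (r - 1) * \<alpha> = (r - 3) / r"
      using r by (simp add: \<alpha>_def field_simps)
    ultimately show ?thesis by (simp only: distrib_left)
  qed
  finally have "(r - 3) / (r - 1) * x\<^sup>2 \<le> ((r - 3) / r + 3 / 2 * \<epsilon>) * x"
    using x by (simp add: mult_right_mono)
  with local have "\<alpha> * \<mu> \<le> ((r - 3) / r + 3 / 2 * \<epsilon>) * x + 2 / r * x + 3 * \<epsilon>"
    unfolding \<alpha>_def by linarith
  also have "((r - 3) / r + 3 / 2 * \<epsilon>) * x + 2 / r * x = \<alpha> * x + 3 / 2 * \<epsilon> * x"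
    using r by (simp add: \<alpha>_def field_simps)
  also have "3 / 2 * \<epsilon> * x \<le> 3 / 2 * \<epsilon> * 1"
    using x \<epsilon> by (intro mult_left_mono) auto
  finally have "\<alpha> * \<mu> \<le> \<alpha> * x + 9 / 2 * \<epsilon>" by simp
  then have *: "\<alpha> * (\<mu> - x) \<le> 9 / 2 * \<epsilon>" by (simp add: right_diff_distrib)
  have "2 / 3 * (7 * \<epsilon>) \<le> \<alpha> * (\<mu> - x)"
    using \<alpha> less \<epsilon> by (intro mult_mono) auto
  also have "\<dots> \<le> 9 / 2 * \<epsilon>" by (rule *)
  finally show False using \<epsilon> by simp
qed

context adjacency
begin

text \<open>Optimality under deletion of \<open>v\<close> gives a lower bound on the sum of the degrees over the neighbours of \<open>v\<close>;
  the local upper bound on the same sum and the sparseness of the neighbourhood turn it into a condition on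
  the degree of \<open>v\<close> alone.\<close>

lemma local_degree_condition:
  fixes r :: nat and \<epsilon> :: real
  assumes V: "finite V" "v \<in> V" and r: "r \<ge> 3"
    and nb: "arcs (nbrs V v) \<le> (1 - 1 / (real r - 1)) * (deg V v)\<^sup>2 + \<epsilon> * (card V)\<^sup>2"
    and del: "excess r (V - {v}) < excess r V + 1"
    and big: "real (card V) + 1 \<le> \<epsilon> * (card V)\<^sup>2"
  shows "(1 - 1 / real r) * arcs V
    \<le> (real r - 3) / (real r - 1) * (deg V v)\<^sup>2 + 2 / real r * deg V v * card V + 3 * \<epsilon> * (card V)\<^sup>2"
proof -
  let ?n = "real (card V)"
  define d where "d = deg V v"
  define \<alpha> where "\<alpha> = 1 - 1 / real r"
  define \<beta> where "\<beta> = 1 - 1 / (real r - 1)"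
  have \<alpha>: "0 \<le> \<alpha>" "\<alpha> \<le> 1" using r by (auto simp: \<alpha>_def)
  have d: "0 \<le> d" "d \<le> ?n" unfolding d_def by (rule deg_nonneg deg_le_card[OF V(1)])+
  have arith: "A \<le> D + 2 * P - x + 1" if "S \<le> P" "A < D + 2 * S - x + 1" for A D P S x :: real
    using that by linarith
  have S: "(\<Sum>u\<in>nbrs V v. deg V u) \<le> \<beta> * d\<^sup>2 + \<epsilon> * ?n\<^sup>2 + d * (?n - d)"
    using sum_nbrs_deg_le[OF V(1), of v] nb unfolding d_def \<beta>_def by simp
  have "\<alpha> * (arcs V + 2 * d * (?n - 1)) < d\<^sup>2 + 2 * (\<Sum>u\<in>nbrs V v. deg V u) - d + 1"
    using del unfolding excess_delete[OF V] d_def \<alpha>_def by linarith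
  from arith[OF S this] have "\<alpha> * (arcs V + 2 * d * (?n - 1))
      \<le> d\<^sup>2 + 2 * (\<beta> * d\<^sup>2 + \<epsilon> * ?n\<^sup>2 + d * (?n - d)) - d + 1" .
  then have "\<alpha> * arcs V \<le> (2 * \<beta> - 1) * d\<^sup>2 + 2 * (1 - \<alpha>) * d * ?n + 2 * \<epsilon> * ?n\<^sup>2 + (2 * (\<alpha> * d) - d + 1)"
    by (simp add: algebra_simps power2_eq_square)
  moreover have "\<alpha> * d \<le> 1 * d" using \<alpha> d by (intro mult_right_mono) auto
  then have "2 * (\<alpha> * d) - d + 1 \<le> \<epsilon> * ?n\<^sup>2" using d big by simp
  moreover have "2 * \<beta> - 1 = (real r - 3) / (real r - 1)" using r by (simp add: \<beta>_def field_simps)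
  moreover have "2 * (1 - \<alpha>) = 2 / real r" by (simp add: \<alpha>_def)
  ultimately show ?thesis unfolding d_def[symmetric] \<alpha>_def[symmetric] by simp
qed

text \<open>Let \<open>\<mu> = arcs V / n\<^sup>2\<close> be the relative average degree. All degrees are at least \<open>(\<mu> - 7 \<epsilon>) n\<close>. Hence the
  degrees are concentrated at their average and the sum of their squares is at most about \<open>\<mu>\<^sup>2 n\<^sup>3\<close>. A nonnegative
  excess says that it is at least \<open>(1 - 1 / r) \<mu> n\<^sup>3\<close>, so \<open>\<mu>\<close> is almost \<open>1 - 1 / r\<close> or larger. Dividing by \<open>\<mu>\<close> is
  harmless because \<open>\<mu> \<ge> 1 / 9\<close>, which turns the error \<open>7 \<epsilon>\<close> into \<open>63 \<epsilon>\<close>.\<close>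

lemma min_degree_if_deletion_stable:
  fixes r :: nat and \<epsilon> :: real
  assumes V: "finite V" and r: "r \<ge> 3" and \<epsilon>: "\<epsilon> > 0"
    and ex: "excess r V \<ge> 0" and pos: "arcs V > 0"
    and nb: "\<And>v. v \<in> V \<Longrightarrow>
      arcs (nbrs V v) \<le> (1 - 1 / (real r - 1)) * (deg V v)\<^sup>2 + \<epsilon> * (card V)\<^sup>2"
    and del: "\<And>v. v \<in> V \<Longrightarrow> excess r (V - {v}) < excess r V + 1"
    and big: "real (card V) + 1 \<le> \<epsilon> * (card V)\<^sup>2"
    and v: "v \<in> V"
  shows "deg V v \<ge> (1 - 1 / real r - 70 * \<epsilon>) * card V"
proof -
  let ?n = "real (card V)"
  let ?Q = "\<Sum>v\<in>V. (deg V v)\<^sup>2"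
  define \<alpha> where "\<alpha> = 1 - 1 / real r"
  define \<mu> where "\<mu> = arcs V / ?n\<^sup>2"
  have n: "?n > 0" using V v by (simp add: card_gt_0_iff) blast
  have a: "arcs V = \<mu> * ?n\<^sup>2" using n by (simp add: \<mu>_def)
  have \<mu>9: "\<mu> \<ge> 1 / 9"
    using arcs_large_if_excess_nonneg[OF V r ex pos] n by (simp add: \<mu>_def field_simps)
  have "?Q \<le> (1 - 1 / real r) * (arcs V * ?n + \<epsilon> * (card V)\<^sup>2 * ?n)"
    using r by (intro sum_deg_sq_le_if_nbrs_sparse[OF V _ nb]) auto
  then have "?n * ?Q \<le> ?n * (\<alpha> * (arcs V * ?n + \<epsilon> * (card V)\<^sup>2 * ?n))"
    unfolding \<alpha>_def by (rule mult_left_mono) simp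
  then have "(\<mu> * ?n\<^sup>2)\<^sup>2 \<le> ?n * (\<alpha> * (\<mu> * ?n\<^sup>2 * ?n + \<epsilon> * ?n\<^sup>2 * ?n))"
    using arcs_sq_le[OF V] a by simp
  then have "\<mu>\<^sup>2 * ?n ^ 4 \<le> (\<alpha> * (\<mu> + \<epsilon>)) * ?n ^ 4"
    by (simp add: algebra_simps power2_eq_square power4_eq_xxxx)
  then have upper: "\<mu>\<^sup>2 \<le> \<alpha> * (\<mu> + \<epsilon>)" using n by simp
  have ge: "deg V u \<ge> (\<mu> - 7 * \<epsilon>) * ?n" if u: "u \<in> V" for u
  proof -
    define x where "x = deg V u / ?n"
    have d: "deg V u = x * ?n" using n by (simp add: x_def)
    have x: "0 \<le> x" "x \<le> 1"
      using deg_nonneg deg_le_card[OF V] n by (auto simp: x_def field_simps)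
    have scale: "p * (x * n)\<^sup>2 + q * (x * n) * n + e * n\<^sup>2 = (p * x\<^sup>2 + q * x + e) * n\<^sup>2"
      for p q e n :: real by (simp add: power2_eq_square algebra_simps)
    have "\<alpha> * (\<mu> * ?n\<^sup>2) \<le> (real r - 3) / (real r - 1) * (x * ?n)\<^sup>2 + 2 / real r * (x * ?n) * ?n
        + 3 * \<epsilon> * ?n\<^sup>2"
      using local_degree_condition[OF V u r nb[OF u] del[OF u] big] unfolding a d \<alpha>_def by simp
    also have "\<dots> = ((real r - 3) / (real r - 1) * x\<^sup>2 + 2 / real r * x + 3 * \<epsilon>) * ?n\<^sup>2"
      by (rule scale)
    finally have "(\<alpha> * \<mu>) * ?n\<^sup>2 \<le> ((real r - 3) / (real r - 1) * x\<^sup>2 + 2 / real r * x + 3 * \<epsilon>) * ?n\<^sup>2"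
      by simp
    then have "\<alpha> * \<mu> \<le> (real r - 3) / (real r - 1) * x\<^sup>2 + 2 / real r * x + 3 * \<epsilon>"
      using n by (simp only: mult_le_cancel_right) auto
    then have "x \<ge> \<mu> - 7 * \<epsilon>"
      using r x \<epsilon> \<mu>9 upper unfolding \<alpha>_def by (intro degree_near_mean_numeric[of "real r"]) auto
    then show ?thesis unfolding d using n by simp
  qed
  \<comment> \<open>Every degree lies between \<open>(\<mu> - 7 \<epsilon>) n\<close> and \<open>n\<close>, so its square lies below the chord of the parabola.\<close>
  have "?Q \<le> (\<Sum>u\<in>V. (1 + (\<mu> - 7 * \<epsilon>)) * ?n * deg V u - (\<mu> - 7 * \<epsilon>) * ?n\<^sup>2)"
  proof (rule sum_mono)
    fix u assume u: "u \<in> V"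
    have "(deg V u - (\<mu> - 7 * \<epsilon>) * ?n) * (?n - deg V u) \<ge> 0"
      using ge[OF u] deg_le_card[OF V, of u] by (intro mult_nonneg_nonneg) auto
    then show "(deg V u)\<^sup>2 \<le> (1 + (\<mu> - 7 * \<epsilon>)) * ?n * deg V u - (\<mu> - 7 * \<epsilon>) * ?n\<^sup>2"
      by (simp add: algebra_simps power2_eq_square)
  qed
  also have "\<dots> = (1 + (\<mu> - 7 * \<epsilon>)) * ?n * arcs V - ?n * ((\<mu> - 7 * \<epsilon>) * ?n\<^sup>2)"
    by (simp add: sum_subtractf sum_distrib_left[symmetric] arcs_def)
  finally have "\<alpha> * (\<mu> * ?n\<^sup>2) * ?n \<le> (1 + (\<mu> - 7 * \<epsilon>)) * ?n * (\<mu> * ?n\<^sup>2) - ?n * ((\<mu> - 7 * \<epsilon>) * ?n\<^sup>2)"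
    using ex unfolding excess_def a \<alpha>_def by linarith
  then have "(\<alpha> * \<mu>) * ?n ^ 3 \<le> (\<mu>\<^sup>2 + 7 * \<epsilon> - 7 * \<epsilon> * \<mu>) * ?n ^ 3"
    by (simp add: algebra_simps power2_eq_square power3_eq_cube)
  then have "\<alpha> * \<mu> \<le> \<mu>\<^sup>2 + 7 * \<epsilon> - 7 * \<epsilon> * \<mu>"
    using n by (simp only: mult_le_cancel_right) auto
  moreover have "7 * \<epsilon> * \<mu> \<ge> 0" using \<epsilon> \<mu>9 by simp
  ultimately have close: "\<mu> * (\<alpha> - \<mu>) \<le> 7 * \<epsilon>" by (simp add: power2_eq_square algebra_simps)
  have "\<mu> \<ge> \<alpha> - 63 * \<epsilon>"
  proof (rule ccontr)
    assume "\<not> \<mu> \<ge> \<alpha> - 63 * \<epsilon>"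
    then have gt: "\<alpha> - \<mu> > 63 * \<epsilon>" by simp
    then have "1 / 9 * (\<alpha> - \<mu>) \<le> \<mu> * (\<alpha> - \<mu>)"
      using \<mu>9 \<epsilon> by (intro mult_right_mono) auto
    also have "\<dots> \<le> 7 * \<epsilon>" by (rule close)
    finally show False using gt by simp
  qed
  then have "(\<alpha> - 70 * \<epsilon>) * ?n \<le> (\<mu> - 7 * \<epsilon>) * ?n"
    by (intro mult_right_mono) auto
  then show ?thesis using ge[OF v] unfolding \<alpha>_def by linarith
qed

lemma excess_le_cube:
  assumes "finite V" "r \<ge> 1"
  shows "excess r V \<le> real (card V) ^ 3"
proof -
  have "(\<Sum>v\<in>V. (deg V v)\<^sup>2) \<le> (\<Sum>v\<in>V. (real (card V))\<^sup>2)"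
    using deg_le_card[OF assms(1)] deg_nonneg by (intro sum_mono power_mono) auto
  moreover have "(1 - 1 / real r) * arcs V * real (card V) \<ge> 0"
    using assms arcs_nonneg by (intro mult_nonneg_nonneg) auto
  ultimately show ?thesis by (simp add: excess_def power2_eq_square power3_eq_cube)
qed

lemma excess_eq_0_if_no_arcs:
  assumes "finite V" "arcs V = 0"
  shows "excess r V = 0"
proof -
  have "deg V v = 0" if "v \<in> V" for v
    using assms that deg_nonneg by (auto simp: arcs_def sum_nonneg_eq_0_iff)
  then show ?thesis using assms by (simp add: excess_def)
qed

end

text \<open>No neighbourhood contains a complete \<open>r\<close>-partite graph with classes of size \<open>t + 1\<close>, so by Erdos-Stone every
  neighbourhood is almost as sparse as if the graph had no clique on \<open>r + 1\<close> vertices. Thus the minimum degree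
  is almost \<open>(1 - 1 / r) n\<close>, edges have few common neighbours, and there is no clique on \<open>r + 1\<close> vertices.\<close>

lemma deletion_stable_imp_clique_free:
  fixes r t :: nat
  assumes r: "r \<ge> 3"
  shows "\<exists>N. \<forall>(E :: 'b \<Rightarrow> 'b \<Rightarrow> bool) V. adjacency E \<longrightarrow> finite V \<longrightarrow> card V \<ge> N \<longrightarrow>
    \<not> adjacency.plus_blowup E (r - 1) t V \<longrightarrow>
    adjacency.excess E r V \<ge> 0 \<longrightarrow> adjacency.arcs E V > 0 \<longrightarrow>
    (\<forall>v\<in>V. adjacency.excess E r (V - {v}) < adjacency.excess E r V + 1) \<longrightarrow>
    adjacency.clique_free E (Suc r) V"
proof -
  \<comment> \<open>The error \<open>c\<close> in the number of common neighbours contributes \<open>1 / (2 r)\<close> to the inequality \<open>small\<close>,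
    the error \<open>\<delta>\<close> in the degrees at most as much again, and the total has to stay below \<open>2 / r\<close>.\<close>
  define c where "c = 1 / (2 * (real r)\<^sup>2 * (real r + 1))"
  define \<delta> where "\<delta> = c / (2 * real r)"
  define \<epsilon> where "\<epsilon> = \<delta> / 70"
  have c: "c > 0" using r by (simp add: c_def)
  have c1: "c \<le> 1 / real r"
  proof -
    have "1 * 1 \<le> real r * (real r + 1)" using r by (intro mult_mono) auto
    then show ?thesis
      unfolding c_def power2_eq_square using r by (intro divide_left_mono) auto
  qed
  have \<epsilon>: "\<epsilon> > 0" using c r by (simp add: \<epsilon>_def \<delta>_def)
  have small: "(real r + 1) * real r * c + 2 * (real r - 1) * (real r + 1) * \<delta> < 2 / real r"
  proof -
    have nz: "real r + 1 \<noteq> 0" "1 + real r \<noteq> 0" by (simp_all add: add_pos_nonneg less_imp_neq[symmetric])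
    have "(real r + 1) * real r * c = 1 / (2 * real r)"
      using r nz by (simp add: c_def divide_simps power2_eq_square)
    moreover have "2 * (real r - 1) * (real r + 1) * \<delta> = (real r - 1) / real r * (1 / (2 * real r * real r))"
      using r nz by (simp add: c_def \<delta>_def divide_simps power2_eq_square)
    moreover have "(real r - 1) / real r * (1 / (2 * real r * real r)) \<le> 1 * (1 / (2 * real r * real r))"
      using r by (intro mult_right_mono) auto
    moreover have "1 / (2 * real r * real r) \<le> 1 / (2 * real r)"
      using r by (intro divide_left_mono) auto
    moreover have "1 / (2 * real r) > 0" "2 / real r = 4 * (1 / (2 * real r))" using r by auto
    ultimately show ?thesis by linarith
  qed
  obtain N1 where N1: "\<forall>(E :: 'b \<Rightarrow> 'b \<Rightarrow> bool) V. adjacency E \<longrightarrow> finite V \<longrightarrow> card V \<ge> N1 \<longrightarrow>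
    \<not> adjacency.plus_blowup E (r - 1) t V \<longrightarrow>
    (\<forall>v\<in>V. adjacency.deg E V v \<ge> (1 - 1 / real r - \<delta>) * card V) \<longrightarrow>
    (\<forall>x\<in>V. \<forall>y\<in>V. E x y \<longrightarrow>
      adjacency.deg E (adjacency.nbrs E V x) y < (1 - 2 / real r + c) * card V)"
    using codegree_less_if_no_plus_blowup[OF r c c1 \<delta>_def, of t] by (rule exE)
  have Sr: "Suc (r - 1) = r" "real (r - 1) = real r - 1" using r by (auto simp: of_nat_diff)
  obtain N2 where N2: "\<forall>(E :: 'b \<Rightarrow> 'b \<Rightarrow> bool) V. adjacency E \<longrightarrow> finite V \<longrightarrow> card V \<ge> N2 \<longrightarrow>
      adjacency.arcs E V \<ge> ((real r - 1 - 1) / (real r - 1) + \<epsilon>) * (card V)\<^sup>2 \<longrightarrow>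
      (\<exists>B. adjacency.multipartite E (Suc (r - 1)) (Suc t) V B)"
    using erdos_stone[OF \<epsilon>, of "r - 1" "Suc t"] unfolding Sr(2) by (rule exE)
  define N where "N = max (Suc N1) (max (nat \<lceil>2 / \<epsilon>\<rceil>) (nat \<lceil>(real N2)\<^sup>2 / \<epsilon>\<rceil>))"
  show ?thesis
  proof (intro exI[of _ N] allI impI)
    fix E :: "'b \<Rightarrow> 'b \<Rightarrow> bool" and V
    assume E: "adjacency E" and V: "finite V" and n: "card V \<ge> N"
      and no: "\<not> adjacency.plus_blowup E (r - 1) t V"
      and ex: "adjacency.excess E r V \<ge> 0" and pos: "adjacency.arcs E V > 0"
      and del: "\<forall>v\<in>V. adjacency.excess E r (V - {v}) < adjacency.excess E r V + 1"
    interpret adjacency E by (rule E)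
    let ?n = "real (card V)"
    have n1: "card V \<ge> 1" "card V \<ge> N1" using n by (auto simp: N_def)
    have "?n \<ge> 2 / \<epsilon>" "?n \<ge> (real N2)\<^sup>2 / \<epsilon>" using n by (auto simp: N_def)
    then have n2: "\<epsilon> * ?n \<ge> 2" "\<epsilon> * ?n \<ge> (real N2)\<^sup>2" using \<epsilon> by (auto simp: field_simps)
    have big: "?n + 1 \<le> \<epsilon> * (card V)\<^sup>2"
    proof -
      have "?n + 1 \<le> 2 * ?n" using n1 by simp
      also have "\<dots> \<le> (\<epsilon> * ?n) * ?n" using n2 by (intro mult_right_mono) auto
      finally show ?thesis by (simp add: power2_eq_square)
    qed
    have N2_le: "(real N2)\<^sup>2 \<le> \<epsilon> * (card V)\<^sup>2"
    proof -
      have "(real N2)\<^sup>2 \<le> \<epsilon> * ?n * 1" using n2 by simp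
      also have "\<dots> \<le> \<epsilon> * ?n * ?n" using n1 \<epsilon> by (intro mult_left_mono) auto
      finally show ?thesis by (simp add: power2_eq_square)
    qed
    have nb: "arcs (nbrs V v) \<le> (1 - 1 / (real r - 1)) * (deg V v)\<^sup>2 + \<epsilon> * (card V)\<^sup>2"
      if v: "v \<in> V" for v
    proof (cases "card (nbrs V v) \<ge> N2")
      case True
      have "\<not> (\<exists>B. multipartite (Suc (r - 1)) (Suc t) (nbrs V v) B)"
        using plus_blowup_if_multipartite_nbrs[OF V v] no by blast
      then have "\<not> ((real r - 1 - 1) / (real r - 1) + \<epsilon>) * (card (nbrs V v))\<^sup>2 \<le> arcs (nbrs V v)"
        using N2[rule_format, OF E finite_nbrs[OF V] True] by blast
      then have "arcs (nbrs V v) \<le> ((real r - 1 - 1) / (real r - 1) + \<epsilon>) * (card (nbrs V v))\<^sup>2"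
        by simp
      also have "\<dots> = (1 - 1 / (real r - 1)) * (deg V v)\<^sup>2 + \<epsilon> * (deg V v)\<^sup>2"
        using r by (simp add: deg_def field_simps)
      also have "\<epsilon> * (deg V v)\<^sup>2 \<le> \<epsilon> * (card V)\<^sup>2"
        using deg_le_card[OF V] deg_nonneg \<epsilon> by (simp add: power_mono)
      finally show ?thesis by simp
    next
      case False
      have "arcs (nbrs V v) \<le> (real (card (nbrs V v)))\<^sup>2"
        using arcs_le_card_sq[OF finite_nbrs[OF V]] by simp
      also have "\<dots> \<le> (real N2)\<^sup>2" using False by (intro power_mono) auto
      also have "\<dots> \<le> \<epsilon> * (card V)\<^sup>2" by (rule N2_le)
      finally have "arcs (nbrs V v) \<le> \<epsilon> * (card V)\<^sup>2" .
      moreover have "(1 - 1 / (real r - 1)) * (deg V v)\<^sup>2 \<ge> 0"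
        using r by (intro mult_nonneg_nonneg) auto
      ultimately show ?thesis by linarith
    qed
    have dV: "deg V v \<ge> (1 - 1 / real r - \<delta>) * ?n" if "v \<in> V" for v
      using min_degree_if_deletion_stable[OF V r \<epsilon> ex pos nb _ big that] del by (simp add: \<epsilon>_def)
    show "clique_free (Suc r) V"
    proof (rule clique_free_if_codegrees_small[OF V _ r dV _ small])
      show "V \<noteq> {}" using n1 by auto
      show "deg (nbrs V x) y \<le> (1 - 2 / real r + c) * ?n" if "x \<in> V" "y \<in> V" "E x y" for x y
        using N1[rule_format, OF E V n1(2) no dV that] by simp
    qed
  qed
qed

text \<open>If the excess is positive and the graph has at least \<open>N\<close> vertices, then some deletion increases the excess
  by at least 1, as otherwise the graph is clique-free and its excess is not positive. Starting with many
  vertices, this can be repeated down to \<open>N\<close> vertices, where the excess is at most \<open>N ^ 3\<close>. So a positive excess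
  bounds the number of vertices. If the excess is 0, then no deletion can increase it at all, and the graph
  itself is clique-free.\<close>

lemma excess_nonpos_if_no_plus_blowup:
  fixes r t :: nat
  assumes r: "r \<ge> 3"
  shows "\<exists>N. \<forall>(E :: 'b \<Rightarrow> 'b \<Rightarrow> bool) V. adjacency E \<longrightarrow> finite V \<longrightarrow> card V \<ge> N \<longrightarrow>
    \<not> adjacency.plus_blowup E (r - 1) t V \<longrightarrow>
    adjacency.excess E r V \<le> 0 \<and>
    (adjacency.arcs E V > 0 \<longrightarrow> adjacency.excess E r V = 0 \<longrightarrow> adjacency.clique_free E (Suc r) V)"
proof -
  obtain N where N_all: "\<forall>(E :: 'b \<Rightarrow> 'b \<Rightarrow> bool) V. adjacency E \<longrightarrow> finite V \<longrightarrow> card V \<ge> N \<longrightarrow>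
    \<not> adjacency.plus_blowup E (r - 1) t V \<longrightarrow>
    adjacency.excess E r V \<ge> 0 \<longrightarrow> adjacency.arcs E V > 0 \<longrightarrow>
    (\<forall>v\<in>V. adjacency.excess E r (V - {v}) < adjacency.excess E r V + 1) \<longrightarrow>
    adjacency.clique_free E (Suc r) V"
    using deletion_stable_imp_clique_free[OF r, of t] by (rule exE)
  have "adjacency.excess E r V \<le> 0 \<and>
      (adjacency.arcs E V > 0 \<longrightarrow> adjacency.excess E r V = 0 \<longrightarrow> adjacency.clique_free E (Suc r) V)"
    if E: "adjacency E" and V: "finite V" "card V \<ge> N + N ^ 3 + 2"
      and no: "\<not> adjacency.plus_blowup E (r - 1) t V" for E :: "'b \<Rightarrow> 'b \<Rightarrow> bool" and V
  proof -
    interpret adjacency E by (rule E)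
    note N = N_all[rule_format, OF E]
    have no_sub: "\<not> plus_blowup (r - 1) t (V - {v})" if "\<not> plus_blowup (r - 1) t V" for V v
      using that plus_blowup_mono by blast
    have desc: "excess r V + j \<le> real N ^ 3"
      if "finite V" "card V = N + j" "\<not> plus_blowup (r - 1) t V" "excess r V > 0" for V j
      using that
    proof (induction j arbitrary: V)
      case 0
      then show ?case using excess_le_cube[of V r] r by simp
    next
      case (Suc j)
      have "arcs V > 0"
        using excess_eq_0_if_no_arcs[OF Suc.prems(1), of r] Suc.prems(4) arcs_nonneg[of V] by fastforce
      have "\<exists>v\<in>V. excess r (V - {v}) \<ge> excess r V + 1"
      proof (rule ccontr)
        assume "\<not> ?thesis"
        then have "clique_free (Suc r) V"
          using Suc.prems \<open>arcs V > 0\<close> by (intro N) (auto simp: not_le)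
        then show False
          using excess_nonpos_if_clique_free[OF Suc.prems(1)] r Suc.prems(4) by fastforce
      qed
      then obtain v where v: "v \<in> V" "excess r (V - {v}) \<ge> excess r V + 1" by blast
      have "excess r (V - {v}) + j \<le> real N ^ 3"
        using Suc.prems v no_sub by (intro Suc.IH) auto
      then show ?case using v(2) by simp
    qed
    have nonpos: "excess r V \<le> 0"
      if "finite V" "card V \<ge> N + N ^ 3 + 1" "\<not> plus_blowup (r - 1) t V" for V
    proof (rule ccontr)
      assume pos: "\<not> excess r V \<le> 0"
      have "card V = N + (card V - N)" using that by simp
      from desc[OF that(1) this that(3)] pos
      have "excess r V + real (card V - N) \<le> real (N ^ 3)" by (simp del: of_nat_diff)
      moreover have "real (card V - N) \<ge> real (N ^ 3 + 1)"
        using that(2) by linarith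
      ultimately show False using pos by linarith
    qed
    show ?thesis
    proof (intro conjI impI)
      show "excess r V \<le> 0" using V no by (intro nonpos) auto
      assume pos: "arcs V > 0" and zero: "excess r V = 0"
      show "clique_free (Suc r) V"
      proof (rule N)
        fix v assume v: "v \<in> V"
        have "excess r (V - {v}) \<le> 0" using V no v no_sub by (intro nonpos) auto
        then show "excess r (V - {v}) < excess r V + 1" using zero by simp
      qed (use V no pos zero in auto)
    qed
  qed
  then show ?thesis by blast
qed

context adjacency
begin

section \<open>The extremal graphs\<close>

text \<open>All inequalities in the argument for clique-free graphs are equalities. The first conclusion says that Turan's
  bound is attained in each neighbourhood, the second that both ends of an edge together see all vertices.\<close>

lemma excess_eq_0_tight:
  fixes r :: nat
  assumes V: "finite V" and r: "r \<ge> 2" and free: "clique_free (Suc r) V" and zero: "excess r V = 0"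
    and v: "v \<in> V"
  shows "arcs (nbrs V v) = (1 - 1 / (real r - 1)) * (deg V v)\<^sup>2"
    and "u \<in> nbrs V v \<Longrightarrow> w \<in> V - nbrs V v \<Longrightarrow> E u w"
proof -
  let ?n = "real (card V)"
  let ?Q = "\<Sum>v\<in>V. (deg V v)\<^sup>2"
  define \<beta> where "\<beta> = 1 - 1 / (real r - 1)"
  define S where "S v = (\<Sum>u\<in>nbrs V v. deg V u)" for v
  define h where "h v = \<beta> * (deg V v)\<^sup>2 + deg V v * (?n - deg V v) - S v" for v
  have S: "S v \<le> arcs (nbrs V v) + deg V v * (?n - deg V v)" for v
    unfolding S_def by (rule sum_nbrs_deg_le[OF V])
  have nb: "arcs (nbrs V v) \<le> \<beta> * (deg V v)\<^sup>2" if "v \<in> V" for v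
    unfolding \<beta>_def by (rule clique_free_arcs_nbrs[OF V free r that])
  have h0: "h v \<ge> 0" if "v \<in> V" for v
    using S[of v] nb[OF that] by (simp add: h_def)
  have "(\<Sum>v\<in>V. h v) = \<beta> * ?Q + (?n * arcs V - ?Q) - ?Q"
    unfolding h_def sum_subtractf sum.distrib S_def sum_nbrs_deg_eq_sum_deg_sq[OF V]
    by (simp add: right_diff_distrib sum_subtractf sum_distrib_left sum_distrib_right arcs_def
        power2_eq_square mult.commute)
  also have "\<dots> = ?n * arcs V - (real r / (real r - 1)) * ?Q"
  proof -
    have "\<beta> - 2 = - (real r / (real r - 1))" using r by (simp add: \<beta>_def field_simps)
    moreover have "\<beta> * q + (x - q) - q = x + (\<beta> - 2) * q" for q x :: real
      by (simp add: algebra_simps)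
    ultimately show ?thesis by simp
  qed
  also have "\<dots> = 0"
  proof -
    have "?Q = (1 - 1 / real r) * arcs V * ?n" using zero by (simp add: excess_def)
    moreover have "(real r / (real r - 1)) * ((1 - 1 / real r) * a * n) = n * a" for a n :: real
      using r by (simp add: field_simps)
    ultimately show ?thesis by simp
  qed
  finally have "h v = 0"
    using sum_nonneg_eq_0_iff[of V h] V h0 v by simp
  then have eq1: "arcs (nbrs V v) = \<beta> * (deg V v)\<^sup>2"
    and eq2: "S v = arcs (nbrs V v) + deg V v * (?n - deg V v)"
    using S[of v] nb[OF v] by (auto simp: h_def)
  show "arcs (nbrs V v) = (1 - 1 / (real r - 1)) * (deg V v)\<^sup>2"
    using eq1 by (simp add: \<beta>_def)
  have le: "real (card (nbrs (V - nbrs V v) u)) \<le> real (card (V - nbrs V v))" for u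
    using V by (intro of_nat_mono card_mono nbrs_subset) auto
  have eq: "(\<Sum>u\<in>nbrs V v. real (card (nbrs (V - nbrs V v) u))) = (\<Sum>u\<in>nbrs V v. real (card (V - nbrs V v)))"
    using eq2 sum_nbrs_deg_eq[OF V, of v] card_non_nbrs[OF V, of v] by (simp add: S_def deg_def)
  assume u: "u \<in> nbrs V v" and w: "w \<in> V - nbrs V v"
  have "real (card (nbrs (V - nbrs V v) u)) = real (card (V - nbrs V v))"
    using sum_mono_inv[OF eq le u finite_nbrs[OF V]] .
  then have "nbrs (V - nbrs V v) u = V - nbrs V v"
    using V by (intro card_subset_eq nbrs_subset) auto
  then show "E u w" using w by (auto simp: nbrs_def)
qed

definition non_nbrs :: "'b set \<Rightarrow> 'b \<Rightarrow> 'b set" where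
  "non_nbrs V v = V - nbrs V v"

text \<open>If both ends of every edge together see all vertices, then non-adjacency is transitive, and its classes are
  the sets of non-neighbours.\<close>

lemma non_nbrs_eq_iff:
  assumes tr: "\<And>x u w. x \<in> V \<Longrightarrow> u \<in> nbrs V x \<Longrightarrow> w \<in> V - nbrs V x \<Longrightarrow> E u w"
    and "x \<in> V" "y \<in> V"
  shows "non_nbrs V x = non_nbrs V y \<longleftrightarrow> \<not> E x y"
proof
  assume eq: "non_nbrs V x = non_nbrs V y"
  have "y \<in> non_nbrs V y" using \<open>y \<in> V\<close> irrefl by (auto simp: non_nbrs_def nbrs_def)
  then show "\<not> E x y" using eq by (auto simp: non_nbrs_def nbrs_def)
next
  have *: "non_nbrs V x \<subseteq> non_nbrs V y" if "x \<in> V" "y \<in> V" "\<not> E x y" for x y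
  proof
    fix z assume z: "z \<in> non_nbrs V x"
    show "z \<in> non_nbrs V y"
    proof (rule ccontr)
      assume "z \<notin> non_nbrs V y"
      then have "y \<in> nbrs V z" using z sym \<open>y \<in> V\<close> by (auto simp: non_nbrs_def nbrs_def)
      moreover have "x \<in> V - nbrs V z" "z \<in> V"
        using z sym \<open>x \<in> V\<close> by (auto simp: non_nbrs_def nbrs_def)
      ultimately have "E y x" using tr by blast
      then show False using that sym by blast
    qed
  qed
  assume "\<not> E x y"
  then show "non_nbrs V x = non_nbrs V y" using *[of x y] *[of y x] assms(2,3) sym by blast
qed

lemma partition_non_nbrs:
  assumes tr: "\<And>x u w. x \<in> V \<Longrightarrow> u \<in> nbrs V x \<Longrightarrow> w \<in> V - nbrs V x \<Longrightarrow> E u w"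
  shows "partition_on V (non_nbrs V ` V)"
proof (rule partition_onI)
  have iff: "non_nbrs V x = non_nbrs V y \<longleftrightarrow> \<not> E x y" if "x \<in> V" "y \<in> V" for x y
    by (rule non_nbrs_eq_iff[OF tr that])
  have self: "x \<in> non_nbrs V x" if "x \<in> V" for x
    using that irrefl by (auto simp: non_nbrs_def nbrs_def)
  show "\<Union> (non_nbrs V ` V) = V" using self by (auto simp: non_nbrs_def)
  show "{} \<notin> non_nbrs V ` V" using self by blast
  fix p q assume "p \<in> non_nbrs V ` V" "q \<in> non_nbrs V ` V" "p \<noteq> q"
  then obtain x y where xy: "x \<in> V" "y \<in> V" "p = non_nbrs V x" "q = non_nbrs V y" by blast
  show "disjnt p q"
  proof (rule ccontr)
    assume "\<not> disjnt p q"
    then obtain z where z: "z \<in> V" "\<not> E x z" "\<not> E y z"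
      unfolding xy by (auto simp: disjnt_def non_nbrs_def nbrs_def)
    then have "p = non_nbrs V z" "q = non_nbrs V z" using iff xy by blast+
    then show False using \<open>p \<noteq> q\<close> by simp
  qed
qed

text \<open>The graph is complete multipartite with at most \<open>r\<close> classes, since representatives of \<open>r + 1\<close> classes would form
  a clique. The neighbourhood of a vertex is the union of the other classes and attains Turan's bound for
  \<open>r - 1\<close> classes. By the variance of their sizes there are exactly \<open>r - 1\<close> of them, all of the same size. As
  \<open>r \<ge> 3\<close>, any two classes are both different from some third one and so have equal size.\<close>

lemma extremal_structure:
  fixes r :: nat
  assumes V: "finite V" and r: "r \<ge> 3" and free: "clique_free (Suc r) V" and zero: "excess r V = 0"
    and pos: "arcs V > 0"
  obtains P where "partition_on V P" "card P = r"
    "\<And>x y. x \<in> V \<Longrightarrow> y \<in> V \<Longrightarrow> E x y \<longleftrightarrow> \<not> (\<exists>A\<in>P. x \<in> A \<and> y \<in> A)"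
    "\<And>x y. x \<in> V \<Longrightarrow> y \<in> V \<Longrightarrow> deg V x = deg V y"
proof -
  have r2: "r \<ge> 2" using r by simp
  note tight = excess_eq_0_tight[OF V r2 free zero]
  have iff: "non_nbrs V x = non_nbrs V y \<longleftrightarrow> \<not> E x y" if "x \<in> V" "y \<in> V" for x y
    by (rule non_nbrs_eq_iff[OF tight(2) that])
  define P where "P = non_nbrs V ` V"
  have part: "partition_on V P" unfolding P_def by (rule partition_non_nbrs[OF tight(2)])
  have self: "x \<in> non_nbrs V x" if "x \<in> V" for x
    using that irrefl by (auto simp: non_nbrs_def nbrs_def)
  have Pf: "finite P" using V by (simp add: P_def)
  have PV: "A \<subseteq> V" if "A \<in> P" for A using that by (auto simp: P_def non_nbrs_def)
  have cls: "A = non_nbrs V x" if A: "A \<in> P" "x \<in> A" for A x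
  proof -
    obtain y where y: "y \<in> V" "A = non_nbrs V y" using A by (auto simp: P_def)
    then have "x \<in> V" "\<not> E y x" using A by (auto simp: non_nbrs_def nbrs_def)
    then show ?thesis using iff y by blast
  qed
  have card_le: "card P \<le> r"
  proof (rule ccontr)
    assume "\<not> card P \<le> r"
    then obtain P0 where P0: "P0 \<subseteq> P" "card P0 = Suc r"
      using obtain_subset_with_card_n[of "Suc r" P] by auto
    have "\<exists>x\<in>V. A = non_nbrs V x" if "A \<in> P0" for A using that P0 by (auto simp: P_def)
    then obtain f where f: "\<And>A. A \<in> P0 \<Longrightarrow> f A \<in> V \<and> A = non_nbrs V (f A)" by metis
    have "inj_on f P0" using f by (metis inj_onI)
    then have "card (f ` P0) = Suc r" using P0 by (simp add: card_image)
    moreover have "clique (f ` P0)"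
      unfolding clique_def using f iff P0 Pf finite_subset by (metis (no_types, lifting) finite_imageI imageE)
    moreover have "f ` P0 \<subseteq> V" using f by blast
    ultimately show False using free by (auto simp: clique_free_def)
  qed
  have sizes: "(deg V v > 0 \<longrightarrow> card (P - {non_nbrs V v}) = r - 1) \<and>
      (\<forall>A\<in>P - {non_nbrs V v}. real (card A) = deg V v / (real r - 1))" if v: "v \<in> V" for v
  proof -
    define P' where "P' = P - {non_nbrs V v}"
    define d where "d = deg V v"
    let ?s = "\<lambda>A. real (card A)"
    have vP: "non_nbrs V v \<in> P" using v by (simp add: P_def)
    have P'f: "finite P'" using Pf by (simp add: P'_def)
    have cP': "card P' \<le> r - 1" using card_le vP Pf by (simp add: P'_def)
    have UP: "nbrs V v = \<Union> P'"
    proof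
      show "nbrs V v \<subseteq> \<Union> P'"
      proof
        fix x assume x: "x \<in> nbrs V v"
        then have "x \<in> V" "E v x" by (auto simp: nbrs_def)
        then have "non_nbrs V x \<in> P'" using iff v sym by (auto simp: P'_def P_def)
        then show "x \<in> \<Union> P'" using self \<open>x \<in> V\<close> by blast
      qed
      show "\<Union> P' \<subseteq> nbrs V v"
      proof
        fix x assume "x \<in> \<Union> P'"
        then obtain A where A: "A \<in> P" "A \<noteq> non_nbrs V v" "x \<in> A" by (auto simp: P'_def)
        then have "non_nbrs V x \<noteq> non_nbrs V v" "x \<in> V" using cls PV by auto
        then show "x \<in> nbrs V v" using iff v by (simp add: nbrs_def) blast
      qed
    qed
    have Af: "finite A" if "A \<in> P'" for A
      using that PV V finite_subset by (metis DiffD1 P'_def)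
    have disj: "A \<inter> B = {}" if "A \<in> P'" "B \<in> P'" "A \<noteq> B" for A B
      using that partition_onD2[OF part] by (auto simp: P'_def disjoint_def)
    have d_sum: "d = (\<Sum>A\<in>P'. ?s A)"
      unfolding d_def deg_def UP using card_Union_disjoint[of P'] Af disj
      by (simp add: pairwise_def disjnt_def)
    have "arcs (nbrs V v) = (\<Sum>A\<in>P'. \<Sum>u\<in>A. deg (nbrs V v) u)"
      unfolding arcs_def UP using Af disj by (subst sum.Union_disjoint) auto
    also have "\<dots> = (\<Sum>A\<in>P'. ?s A * (d - ?s A))"
    proof (intro sum.cong refl)
      fix A assume A: "A \<in> P'"
      have "deg (nbrs V v) u = d - ?s A" if u: "u \<in> A" for u
      proof -
        have A': "A \<in> P" "A \<subseteq> nbrs V v" using A UP by (auto simp: P'_def)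
        then have "u \<in> V" using u nbrs_subset by blast
        have "A = non_nbrs V u" by (rule cls[OF A'(1) u])
        then have "nbrs (nbrs V v) u = nbrs V v - A"
          using nbrs_subset[of V v] by (auto simp: non_nbrs_def nbrs_def)
        then show ?thesis
          using A' Af[OF A] finite_nbrs[OF V, of v]
          by (simp add: deg_def d_def card_Diff_subset card_mono of_nat_diff)
      qed
      then show "(\<Sum>u\<in>A. deg (nbrs V v) u) = ?s A * (d - ?s A)" by simp
    qed
    also have "\<dots> = d\<^sup>2 - (\<Sum>A\<in>P'. (?s A)\<^sup>2)"
      by (simp add: right_diff_distrib sum_subtractf sum_distrib_right[symmetric] d_sum[symmetric]
          power2_eq_square)
    finally have "arcs (nbrs V v) = d\<^sup>2 - (\<Sum>A\<in>P'. (?s A)\<^sup>2)" .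
    moreover have "arcs (nbrs V v) = (1 - 1 / (real r - 1)) * d\<^sup>2"
      unfolding d_def by (rule tight(1)[OF v])
    ultimately have sq: "(\<Sum>A\<in>P'. (?s A)\<^sup>2) = d\<^sup>2 / (real r - 1)" by (simp add: left_diff_distrib)
    define q where "q = d / (real r - 1)"
    have dq: "d = q * (real r - 1)" using r by (simp add: q_def)
    \<comment> \<open>The deviation of the sizes from \<open>q = d / (r - 1)\<close> has the sign of \<open>card P' - (r - 1) \<le> 0\<close>.\<close>
    have "(\<Sum>A\<in>P'. (?s A - q)\<^sup>2) = (\<Sum>A\<in>P'. (?s A)\<^sup>2 - 2 * q * ?s A + q\<^sup>2)"
      by (intro sum.cong refl) (simp add: power2_diff)
    also have "\<dots> = (\<Sum>A\<in>P'. (?s A)\<^sup>2) - 2 * q * d + card P' * q\<^sup>2"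
      by (simp add: sum.distrib sum_subtractf sum_distrib_left[symmetric] d_sum[symmetric])
    also have "\<dots> = - (real r - 1 - card P') * q\<^sup>2"
      unfolding sq using r by (simp add: dq field_simps power2_eq_square)
    finally have var: "(\<Sum>A\<in>P'. (?s A - q)\<^sup>2) = - (real r - 1 - card P') * q\<^sup>2" .
    have "real (card P') \<le> real r - 1" using cP' r by linarith
    then have "(real r - 1 - card P') * q\<^sup>2 \<ge> 0" by simp
    moreover have "(\<Sum>A\<in>P'. (?s A - q)\<^sup>2) \<ge> 0" by (simp add: sum_nonneg)
    ultimately have z: "(\<Sum>A\<in>P'. (?s A - q)\<^sup>2) = 0" "(real r - 1 - card P') * q\<^sup>2 = 0"
      using var by linarith+
    have "\<forall>A\<in>P'. ?s A = q" using z(1) P'f by (simp add: sum_nonneg_eq_0_iff)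
    moreover have "card P' = r - 1" if "d > 0"
    proof -
      have "q \<noteq> 0" using that r by (simp add: q_def)
      then have "real (card P') = real r - 1" using z(2) by simp
      then show ?thesis using r by linarith
    qed
    ultimately show ?thesis by (simp add: P'_def d_def q_def)
  qed
  have "\<exists>v\<in>V. deg V v > 0"
  proof (rule ccontr)
    assume "\<not> ?thesis"
    then have "\<forall>v\<in>V. deg V v = 0" using deg_nonneg by (meson dual_order.antisym not_le)
    then show False using pos by (simp add: arcs_def)
  qed
  then obtain v0 where v0: "v0 \<in> V" "deg V v0 > 0" by blast
  have "card (P - {non_nbrs V v0}) = r - 1" "non_nbrs V v0 \<in> P"
    using sizes[OF v0(1)] v0 by (auto simp: P_def)
  then have cP: "card P = r" using r Pf by (simp add: card_Diff_singleton)
  have regular: "deg V x = deg V y" if "x \<in> V" "y \<in> V" for x y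
  proof -
    have "card {non_nbrs V x, non_nbrs V y} \<le> 2" by (simp add: card_insert_if)
    then have "\<not> P \<subseteq> {non_nbrs V x, non_nbrs V y}"
      using cP r card_mono[of "{non_nbrs V x, non_nbrs V y}" P] by fastforce
    then obtain w where w: "w \<in> V" "non_nbrs V w \<noteq> non_nbrs V x" "non_nbrs V w \<noteq> non_nbrs V y"
      by (auto simp: P_def)
    have "real (card (non_nbrs V x)) = real (card (non_nbrs V y))"
      using sizes[OF w(1)] w(2,3) that by (simp add: P_def)
    then show ?thesis using card_non_nbrs[OF V] by (simp add: non_nbrs_def)
  qed
  show thesis
  proof (rule that[OF part cP _ regular])
    fix x y assume xy: "x \<in> V" "y \<in> V"
    show "E x y \<longleftrightarrow> \<not> (\<exists>A\<in>P. x \<in> A \<and> y \<in> A)"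
    proof
      assume "E x y"
      then show "\<not> (\<exists>A\<in>P. x \<in> A \<and> y \<in> A)" using cls iff[OF xy] by blast
    next
      assume "\<not> (\<exists>A\<in>P. x \<in> A \<and> y \<in> A)"
      moreover have "non_nbrs V x \<in> P" using xy by (simp add: P_def)
      ultimately have "non_nbrs V x \<noteq> non_nbrs V y" using self xy by blast
      then show "E x y" using iff[OF xy] by blast
    qed
  qed
qed

text \<open>Equal degrees force equal class sizes \<open>s\<close>, so \<open>n = r * s\<close>, all degrees are \<open>(r - 1) * s\<close>, and both terms of the
  excess equal \<open>n * (r - 1)\<^sup>2 * s\<^sup>2\<close>.\<close>

lemma excess_eq_0_if_balanced:
  fixes r :: nat
  assumes V: "finite V" and P: "partition_on V P" "card P = r" and r: "r \<ge> 1"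
    and E: "\<And>x y. x \<in> V \<Longrightarrow> y \<in> V \<Longrightarrow> E x y \<longleftrightarrow> \<not> (\<exists>A\<in>P. x \<in> A \<and> y \<in> A)"
    and reg: "\<And>x y. x \<in> V \<Longrightarrow> y \<in> V \<Longrightarrow> deg V x = deg V y"
  shows "excess r V = 0"
proof -
  let ?n = "real (card V)"
  have card_cls: "real (card A) = ?n - deg V x" if A: "A \<in> P" "x \<in> A" for A x
  proof -
    have AV: "A \<subseteq> V" using that P partition_onD1 by blast
    have "V - nbrs V x = A"
    proof
      show "A \<subseteq> V - nbrs V x" using AV E that by (auto simp: nbrs_def)
      show "V - nbrs V x \<subseteq> A"
      proof
        fix y assume y: "y \<in> V - nbrs V x"
        then obtain B where B: "B \<in> P" "x \<in> B" "y \<in> B"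
          using E[of x y] AV A unfolding nbrs_def by blast
        then have "A = B" using partition_onD2[OF P(1)] A by (auto simp: disjoint_def)
        then show "y \<in> A" using B by simp
      qed
    qed
    then show ?thesis using card_non_nbrs[OF V, of x] by simp
  qed
  have "P \<noteq> {}" using P(2) r by auto
  then obtain A0 where A0: "A0 \<in> P" by blast
  then obtain x0 where x0: "x0 \<in> A0" using partition_onD3[OF P(1)] by fastforce
  have "x0 \<in> V" using A0 x0 P partition_onD1 by blast
  define s where "s = ?n - deg V x0"
  have s: "real (card A) = s" if A: "A \<in> P" for A
  proof -
    obtain x where x: "x \<in> A" using partition_onD3[OF P(1)] A by fastforce
    have "x \<in> V" using A x P partition_onD1 by blast
    then show ?thesis using card_cls[OF A x] reg[of x x0] \<open>x0 \<in> V\<close> by (simp add: s_def)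
  qed
  have "card V = (\<Sum>A\<in>P. card A)"
    by (rule product_partition[OF P(1)]) (use P V partition_onD1 in \<open>metis Sup_upper finite_subset\<close>)
  then have n: "?n = real r * s" using s P(2) by simp
  have deg: "deg V x = (real r - 1) * s" if "x \<in> V" for x
    using reg[OF that \<open>x0 \<in> V\<close>] n by (simp add: s_def algebra_simps)
  show ?thesis
    unfolding excess_def arcs_def using r by (simp add: deg n power2_eq_square field_simps)
qed

end

section \<open>Color-critical graphs and the main theorem\<close>

definition adjacent :: "'b graph \<Rightarrow> 'b \<Rightarrow> 'b \<Rightarrow> bool" where
  "adjacent G x y \<longleftrightarrow> {x, y} \<in> edges G"

lemma adjacency_adjacent:
  assumes "simple_graph G" shows "adjacency (adjacent G)"
proof
  show "adjacent G y x" if "adjacent G x y" for x y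
    using that by (simp add: adjacent_def insert_commute)
  show "\<not> adjacent G x x" for x
    using assms unfolding simple_graph_def adjacent_def by force
qed

lemma finite_edges: "simple_graph G \<Longrightarrow> finite (edges G)"
  unfolding simple_graph_def by (rule finite_subset[of _ "Pow (verts G)"]) auto

lemma deg_eq_degree:
  assumes G: "simple_graph G" and v: "v \<in> verts G"
  shows "adjacency.deg (adjacent G) (verts G) v = real (degree G v)"
proof -
  interpret adjacency "adjacent G" by (rule adjacency_adjacent[OF G])
  have "bij_betw (\<lambda>w. {v, w}) (nbrs (verts G) v) {e \<in> edges G. v \<in> e}"
    unfolding bij_betw_def
  proof
    show "inj_on (\<lambda>w. {v, w}) (nbrs (verts G) v)"
      by (auto simp: inj_on_def doubleton_eq_iff)
    show "(\<lambda>w. {v, w}) ` nbrs (verts G) v = {e \<in> edges G. v \<in> e}"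
    proof
      show "(\<lambda>w. {v, w}) ` nbrs (verts G) v \<subseteq> {e \<in> edges G. v \<in> e}"
        by (auto simp: nbrs_def adjacent_def)
      show "{e \<in> edges G. v \<in> e} \<subseteq> (\<lambda>w. {v, w}) ` nbrs (verts G) v"
      proof
        fix e assume e: "e \<in> {e \<in> edges G. v \<in> e}"
        then have "card e = 2" "e \<subseteq> verts G" using G by (auto simp: simple_graph_def)
        then obtain w where "e = {v, w}" using e by (auto simp: card_2_iff)
        then show "e \<in> (\<lambda>w. {v, w}) ` nbrs (verts G) v"
          using e \<open>e \<subseteq> verts G\<close> by (auto simp: nbrs_def adjacent_def)
      qed
    qed
  qed
  then show ?thesis by (simp add: deg_def degree_def bij_betw_same_card)
qed

lemma arcs_eq_twice_card_edges:
  assumes G: "simple_graph G"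
  shows "adjacency.arcs (adjacent G) (verts G) = 2 * real (card (edges G))"
proof -
  interpret adjacency "adjacent G" by (rule adjacency_adjacent[OF G])
  have fin: "finite (verts G)" "finite (edges G)"
    using G finite_edges[OF G] by (simp_all add: simple_graph_def)
  have "(\<Sum>v\<in>verts G. degree G v) = (\<Sum>v\<in>verts G. \<Sum>e\<in>edges G. if v \<in> e then 1 else 0)"
    using fin by (simp add: degree_def sum.If_cases Int_def)
  also have "\<dots> = (\<Sum>e\<in>edges G. \<Sum>v\<in>verts G. if v \<in> e then 1 else 0)"
    by (rule sum.swap)
  also have "\<dots> = (\<Sum>e\<in>edges G. 2)"
  proof (intro sum.cong refl)
    fix e assume "e \<in> edges G"
    then have "e \<subseteq> verts G" "card e = 2" using G by (auto simp: simple_graph_def)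
    then have "{v \<in> verts G. v \<in> e} = e" "card e = 2" by auto
    then show "(\<Sum>v\<in>verts G. if v \<in> e then 1 else 0) = (2::nat)"
      using fin by (simp add: sum.If_cases Int_def)
  qed
  finally have "(\<Sum>v\<in>verts G. degree G v) = card (edges G) * 2" by simp
  then have "real (\<Sum>v\<in>verts G. degree G v) = 2 * real (card (edges G))" by simp
  then show ?thesis using deg_eq_degree[OF G] by (simp add: arcs_def)
qed

lemma excess_eq:
  assumes G: "simple_graph G"
  shows "adjacency.excess (adjacent G) r (verts G) = (\<Sum>v\<in>verts G. (real (degree G v))\<^sup>2)
    - 2 * (1 - 1 / real r) * real (card (edges G)) * real (card (verts G))"
proof -
  interpret adjacency "adjacent G" by (rule adjacency_adjacent[OF G])
  show ?thesis
    using deg_eq_degree[OF G] by (simp add: excess_def arcs_eq_twice_card_edges[OF G])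
qed

text \<open>A set of pairs is determined by the adjacency of vertices, so the edge set in the definition can be replaced
  by a condition on pairs of vertices.\<close>

lemma complete_multipartite_iff:
  assumes G: "simple_graph G"
  shows "complete_multipartite r G \<longleftrightarrow> (\<exists>P. partition_on (verts G) P \<and> card P = r \<and>
    (\<forall>x\<in>verts G. \<forall>y\<in>verts G. adjacent G x y \<longleftrightarrow> \<not> (\<exists>A\<in>P. x \<in> A \<and> y \<in> A)))"
proof -
  have edges_iff: "edges G = {{u, v} | u v. \<exists>A\<in>P. \<exists>B\<in>P. A \<noteq> B \<and> u \<in> A \<and> v \<in> B} \<longleftrightarrow>
      (\<forall>x\<in>verts G. \<forall>y\<in>verts G. adjacent G x y \<longleftrightarrow> \<not> (\<exists>A\<in>P. x \<in> A \<and> y \<in> A))"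
    (is "edges G = ?C \<longleftrightarrow> ?R") if P: "partition_on (verts G) P" for P
  proof -
    have V: "verts G = \<Union> P" using P by (rule partition_onD1)
    have uniq: "A = B" if "A \<in> P" "B \<in> P" "x \<in> A" "x \<in> B" for A B x
      using that partition_onD2[OF P] by (auto simp: disjoint_def)
    have C: "{x, y} \<in> ?C \<longleftrightarrow> \<not> (\<exists>A\<in>P. x \<in> A \<and> y \<in> A)" if xy: "x \<in> verts G" "y \<in> verts G" for x y
    proof
      assume "{x, y} \<in> ?C"
      then obtain u v A B where uv: "{x, y} = {u, v}" "A \<in> P" "B \<in> P" "A \<noteq> B" "u \<in> A" "v \<in> B"
        by blast
      then show "\<not> (\<exists>A\<in>P. x \<in> A \<and> y \<in> A)" using uniq by (metis doubleton_eq_iff)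
    next
      assume no: "\<not> (\<exists>A\<in>P. x \<in> A \<and> y \<in> A)"
      obtain A B where "A \<in> P" "x \<in> A" "B \<in> P" "y \<in> B" using xy V by blast
      then show "{x, y} \<in> ?C" using no by blast
    qed
    have pairs: "\<exists>x\<in>verts G. \<exists>y\<in>verts G. e = {x, y}" if "e \<in> edges G \<union> ?C" for e
      using that
    proof
      assume "e \<in> edges G"
      then have "card e = 2" "e \<subseteq> verts G" using G by (auto simp: simple_graph_def)
      then show ?thesis by (auto simp: card_2_iff)
    next
      assume "e \<in> ?C"
      then show ?thesis using V by blast
    qed
    show ?thesis
    proof
      assume eq: "edges G = ?C"
      show ?R
        unfolding adjacent_def eq by (intro ballI C)
    next
      assume R: ?R
      show "edges G = ?C"
      proof (rule set_eqI)
        fix e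
        show "e \<in> edges G \<longleftrightarrow> e \<in> ?C"
        proof (cases "e \<in> edges G \<union> ?C")
          case True
          then obtain x y where xy: "x \<in> verts G" "y \<in> verts G" "e = {x, y}"
            using pairs[OF True] by (elim bexE)
          have "e \<in> edges G \<longleftrightarrow> \<not> (\<exists>A\<in>P. x \<in> A \<and> y \<in> A)"
            using R xy by (simp add: adjacent_def)
          then show ?thesis unfolding xy(3) C[OF xy(1,2)] .
        qed blast
      qed
    qed
  qed
  show ?thesis
    unfolding complete_multipartite_def by (intro ex_cong1 conj_cong refl) (erule edges_iff)
qed

lemma regular_iff_deg:
  assumes G: "simple_graph G"
  shows "regular G \<longleftrightarrow> (\<forall>x\<in>verts G. \<forall>y\<in>verts G.
    adjacency.deg (adjacent G) (verts G) x = adjacency.deg (adjacent G) (verts G) y)"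
  unfolding regular_def using deg_eq_degree[OF G] by simp

lemma proper_coloring_chromatic_number:
  assumes "simple_graph G"
  shows "\<exists>c. proper_coloring G (chromatic_number G) c"
proof -
  have "finite (verts G)" using assms by (simp add: simple_graph_def)
  then obtain c where c: "bij_betw c (verts G) {0..<card (verts G)}"
    using ex_bij_betw_finite_nat by blast
  have "proper_coloring G (card (verts G)) c"
    unfolding proper_coloring_def
  proof (intro conjI allI impI ballI)
    fix v assume "v \<in> verts G"
    then show "c v < card (verts G)" using c by (auto simp: bij_betw_def)
  next
    fix u v assume "{u, v} \<in> edges G"
    then have "u \<in> verts G" "v \<in> verts G" "card {u, v} = 2"
      using assms unfolding simple_graph_def by blast+
    then have "u \<noteq> v" by auto
    then show "c u \<noteq> c v" using c \<open>u \<in> _\<close> \<open>v \<in> _\<close> by (auto simp: bij_betw_def inj_on_def)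
  qed
  then show ?thesis unfolding chromatic_number_def
    by (rule_tac LeastI_ex) blast
qed

lemma not_proper_coloring_below_chromatic_number:
  "k < chromatic_number G \<Longrightarrow> \<not> proper_coloring G k c"
  unfolding chromatic_number_def using not_less_Least by blast

text \<open>A coloring of \<open>F\<close> minus its critical edge with \<open>r\<close> colors gives both ends of that edge the same color, as
  otherwise it would color \<open>F\<close>. Exchanging two colors makes this the last color \<open>r - 1\<close>.\<close>

lemma critical_coloring:
  assumes F: "simple_graph F" and crit: "color_critical F" and \<chi>: "chromatic_number F = r + 1"
    and r: "r \<ge> 1"
  obtains x y c where "{x, y} \<in> edges F" "x \<noteq> y" "x \<in> verts F" "y \<in> verts F"
    "\<And>v. v \<in> verts F \<Longrightarrow> c v < r" "c x = r - 1" "c y = r - 1"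
    "\<And>u v. {u, v} \<in> edges F \<Longrightarrow> {u, v} \<noteq> {x, y} \<Longrightarrow> c u \<noteq> c v"
proof -
  obtain e where e: "e \<in> edges F" "chromatic_number (delete_edge F e) < r + 1"
    using crit \<chi> by (auto simp: color_critical_def)
  have "card e = 2" "e \<subseteq> verts F" using F e by (auto simp: simple_graph_def)
  then obtain x y where xy: "e = {x, y}" "x \<noteq> y" "x \<in> verts F" "y \<in> verts F"
    by (auto simp: card_2_iff)
  have "simple_graph (delete_edge F e)" using F by (auto simp: simple_graph_def delete_edge_def)
  then obtain c where c: "proper_coloring (delete_edge F e) (chromatic_number (delete_edge F e)) c"
    using proper_coloring_chromatic_number by blast
  have less: "c v < r" if "v \<in> verts F" for v
    using c e(2) that by (fastforce simp: proper_coloring_def delete_edge_def)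
  have ne: "c u \<noteq> c v" if "{u, v} \<in> edges F" "{u, v} \<noteq> {x, y}" for u v
    using c that xy by (auto simp: proper_coloring_def delete_edge_def)
  have cxy: "c x = c y"
  proof (rule ccontr)
    assume "c x \<noteq> c y"
    then have "proper_coloring F r c"
      using less ne unfolding proper_coloring_def by (metis doubleton_eq_iff)
    then show False using not_proper_coloring_below_chromatic_number[of r F c] \<chi> by simp
  qed
  define \<pi> where "\<pi> i = (if i = c x then r - 1 else if i = r - 1 then c x else i)" for i
  have inj: "\<pi> i = \<pi> j \<Longrightarrow> i = j" for i j by (auto simp: \<pi>_def split: if_splits)
  show thesis
  proof (rule that[of x y "\<pi> \<circ> c"])
    show "(\<pi> \<circ> c) v < r" if "v \<in> verts F" for v
      using less[OF that] less[OF xy(3)] r by (auto simp: \<pi>_def)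
    show "(\<pi> \<circ> c) u \<noteq> (\<pi> \<circ> c) v" if "{u, v} \<in> edges F" "{u, v} \<noteq> {x, y}" for u v
      using ne[OF that] inj by auto
  qed (use e xy cxy in \<open>auto simp: \<pi>_def\<close>)
qed

lemma subgraph_embedding_not_free:
  assumes F: "simple_graph F" and inj: "inj_on g (verts F)" and V: "g ` verts F \<subseteq> verts G"
    and hom: "\<And>u v. {u, v} \<in> edges F \<Longrightarrow> {g u, g v} \<in> edges G"
  shows "\<not> free_of F G"
proof -
  define H where "H = (g ` verts F, (`) g ` edges F)"
  have Fe: "e \<subseteq> verts F" "card e = 2" if "e \<in> edges F" for e
    using F that by (auto simp: simple_graph_def)
  have "simple_graph H"
    using F Fe inj unfolding simple_graph_def H_def
    by (auto simp: card_image inj_on_subset)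
  moreover have "edges H \<subseteq> edges G"
  proof
    fix e' assume "e' \<in> edges H"
    then obtain e where e: "e \<in> edges F" "e' = g ` e" by (auto simp: H_def)
    then have "card e = 2" using Fe by blast
    then obtain u v where "e = {u, v}" by (auto simp: card_2_iff)
    then show "e' \<in> edges G" using hom e by auto
  qed
  ultimately have "subgraph H G" using V by (simp add: subgraph_def H_def)
  moreover have "isomorphic F H"
    unfolding isomorphic_def
  proof (intro exI[of _ g] conjI ballI)
    show "bij_betw g (verts F) (verts H)" using inj by (simp add: bij_betw_def H_def)
    fix u v assume uv: "u \<in> verts F" "v \<in> verts F"
    show "{u, v} \<in> edges F \<longleftrightarrow> {g u, g v} \<in> edges H"
    proof
      assume "{u, v} \<in> edges F"
      then have "g ` {u, v} \<in> edges H" unfolding H_def by (simp del: image_insert)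
      then show "{g u, g v} \<in> edges H" by simp
    next
      assume "{g u, g v} \<in> edges H"
      then obtain e where e: "e \<in> edges F" "g ` {u, v} = g ` e" by (auto simp: H_def)
      then have "{u, v} = e"
        using inj_on_image_eq_iff[OF inj, of "{u, v}" e] uv Fe by auto
      then show "{u, v} \<in> edges F" using e by simp
    qed
  qed
  ultimately show ?thesis unfolding free_of_def by blast
qed

text \<open>Color class \<open>i < r - 1\<close> of \<open>F\<close> goes into \<open>B i\<close>, the critical edge goes to the extra edge \<open>x y\<close>, and the other
  vertices of the last color go into \<open>W\<close>. All classes have room, being as large as the vertex set of \<open>F\<close>.\<close>

lemma color_critical_not_free_if_plus_blowup:
  assumes F: "simple_graph F" and crit: "color_critical F" and \<chi>: "chromatic_number F = r + 1"
    and r: "r \<ge> 1" and G: "simple_graph G"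
    and blow: "adjacency.plus_blowup (adjacent G) (r - 1) (card (verts F)) (verts G)"
  shows "\<not> free_of F G"
proof -
  interpret adjacency "adjacent G" by (rule adjacency_adjacent[OF G])
  obtain a b c where ab: "{a, b} \<in> edges F" "a \<noteq> b" "a \<in> verts F" "b \<in> verts F"
    and c: "\<And>v. v \<in> verts F \<Longrightarrow> c v < r" "c a = r - 1" "c b = r - 1"
    "\<And>u v. {u, v} \<in> edges F \<Longrightarrow> {u, v} \<noteq> {a, b} \<Longrightarrow> c u \<noteq> c v"
    using critical_coloring[OF F crit \<chi> r] by metis
  obtain x y W B where xy: "x \<in> verts G" "y \<in> verts G" "adjacent G x y"
    and W: "W \<subseteq> verts G - {x, y}" "finite W" "card W = card (verts F)"
    and B: "multipartite (r - 1) (card (verts F)) (verts G) B"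
    and J: "\<forall>i<r - 1. joined W (B i) \<and> joined {x, y} (B i)"
    using blow unfolding plus_blowup_def by blast
  have Ff: "finite (verts F)" using F by (simp add: simple_graph_def)
  obtain \<psi> where \<psi>: "bij_betw \<psi> (verts F) W"
    using finite_same_card_bij[OF Ff W(2) W(3)[symmetric]] by blast
  have "\<exists>\<phi>. bij_betw \<phi> (verts F) (B i)" if "i < r - 1" for i
    using finite_same_card_bij[OF Ff, of "B i"] B that unfolding multipartite_def by metis
  then obtain \<phi> where \<phi>: "\<And>i. i < r - 1 \<Longrightarrow> bij_betw (\<phi> i) (verts F) (B i)" by metis
  define M where "M = insert x (insert y W)"
  define C where "C i = (if i = r - 1 then M else B i)" for i
  define g where "g v = (if v = a then x else if v = b then y
    else if c v = r - 1 then \<psi> v else \<phi> (c v) v)" for v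
  have gC: "g v \<in> C (c v)" if v: "v \<in> verts F" for v
  proof (cases "c v = r - 1")
    case True
    then show ?thesis using \<psi> v by (auto simp: g_def C_def M_def bij_betw_def)
  next
    case False
    then have "c v < r - 1" "v \<noteq> a" "v \<noteq> b" using c(1)[OF v] c(2,3) by auto
    then show ?thesis using False \<phi>[of "c v"] v by (auto simp: g_def C_def bij_betw_def)
  qed
  have adj: "adjacent G u v" if ij: "u \<in> C i" "v \<in> C j" "i < r" "j < r" "i \<noteq> j" for u v i j
  proof -
    have BB: "joined (B i) (B j)" if "i < r - 1" "j < r - 1" "i \<noteq> j" for i j
      using B that by (auto simp: multipartite_def)
    have MB: "joined M (B i)" if "i < r - 1" for i
      using J that by (auto simp: M_def joined_def)
    consider "i = r - 1" "j < r - 1" | "j = r - 1" "i < r - 1" | "i < r - 1" "j < r - 1"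
      using ij by linarith
    then show ?thesis
    proof cases
      case 1
      then show ?thesis using ij MB[of j] by (simp add: C_def joined_def)
    next
      case 2
      then show ?thesis using ij MB[of i] sym[of v u] by (simp add: C_def joined_def)
    next
      case 3
      then show ?thesis using ij BB[of i j] by (simp add: C_def joined_def)
    qed
  qed
  have CV: "C i \<subseteq> verts G" if "i < r" for i
    using that xy W B by (auto simp: C_def M_def multipartite_def)
  have xyne: "x \<noteq> y" using xy irrefl by blast
  show ?thesis
  proof (rule subgraph_embedding_not_free[OF F])
    show "g ` verts F \<subseteq> verts G" using gC CV c(1) by blast
    show "inj_on g (verts F)"
    proof (rule inj_onI)
      fix u v assume uv: "u \<in> verts F" "v \<in> verts F" and eq: "g u = g v"
      have same: "c u = c v"
      proof (rule ccontr)
        assume "c u \<noteq> c v"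
        then have "adjacent G (g u) (g v)" using adj gC uv c(1) by blast
        then show False using eq irrefl by simp
      qed
      show "u = v"
      proof (cases "c u = r - 1")
        case True
        have "\<psi> w \<notin> {x, y}" if "w \<in> verts F" for w using \<psi> W(1) that by (auto simp: bij_betw_def)
        moreover have "\<psi> u = \<psi> v \<Longrightarrow> u = v" using \<psi> uv by (auto simp: bij_betw_def inj_on_def)
        ultimately show ?thesis
          using eq uv True same xyne by (auto simp: g_def split: if_splits)
      next
        case False
        then have "u \<notin> {a, b}" "v \<notin> {a, b}" "c u < r - 1" using c uv same by fastforce+
        then show ?thesis
          using eq uv same False \<phi>[of "c u"] by (auto simp: g_def bij_betw_def inj_on_def)
      qed
    qed
    fix u v assume e: "{u, v} \<in> edges F"
    then have uv: "u \<in> verts F" "v \<in> verts F" using F unfolding simple_graph_def by blast+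
    show "{g u, g v} \<in> edges G"
    proof (cases "{u, v} = {a, b}")
      case True
      then have "{g u, g v} = {x, y}" using ab(2) by (auto simp: g_def doubleton_eq_iff)
      then show ?thesis using xy(3) by (simp add: adjacent_def)
    next
      case False
      then have "adjacent G (g u) (g v)" using adj gC uv c(1) c(4)[OF e False] by blast
      then show ?thesis by (simp add: adjacent_def)
    qed
  qed
qed

theorem theorem2p6:
  fixes F :: "'a graph" and r :: nat
  assumes "simple_graph F"
    and "color_critical F"
    and "chromatic_number F = r + 1"
    and "r + 1 \<ge> 4"
  shows "\<exists>n0::nat. \<forall>(G :: 'b graph) (n::nat) (m::nat).
    simple_graph G \<longrightarrow> free_of F G \<longrightarrow>
    card (verts G) = n \<longrightarrow> n \<ge> n0 \<longrightarrow> card (edges G) = m \<longrightarrow>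
      (\<Sum>v\<in>verts G. (real (degree G v))^2) \<le> 2 * (1 - 1 / real r) * real m * real n \<and>
      (m > 0 \<longrightarrow>
        ((\<Sum>v\<in>verts G. (real (degree G v))^2) = 2 * (1 - 1 / real r) * real m * real n
          \<longleftrightarrow> complete_multipartite r G \<and> regular G))"
proof -
  have r: "r \<ge> 3" "r \<ge> 1" using assms(4) by simp_all
  obtain N where N: "\<forall>(E :: 'b \<Rightarrow> 'b \<Rightarrow> bool) V. adjacency E \<longrightarrow> finite V \<longrightarrow> card V \<ge> N \<longrightarrow>
    \<not> adjacency.plus_blowup E (r - 1) (card (verts F)) V \<longrightarrow>
    adjacency.excess E r V \<le> 0 \<and>
    (adjacency.arcs E V > 0 \<longrightarrow> adjacency.excess E r V = 0 \<longrightarrow> adjacency.clique_free E (Suc r) V)"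
    using excess_nonpos_if_no_plus_blowup[OF r(1), of "card (verts F)"] by (rule exE)
  show ?thesis
  proof (intro exI[of _ N] allI impI)
    fix G :: "'b graph" and n m :: nat
    assume G: "simple_graph G" and free: "free_of F G" and n: "card (verts G) = n" "n \<ge> N"
      and m: "card (edges G) = m"
    interpret adjacency "adjacent G" by (rule adjacency_adjacent[OF G])
    let ?V = "verts G"
    have V: "finite ?V" using G by (simp add: simple_graph_def)
    have "\<not> plus_blowup (r - 1) (card (verts F)) ?V"
      using color_critical_not_free_if_plus_blowup[OF assms(1-3) r(2) G] free by blast
    then have ex: "excess r ?V \<le> 0" "arcs ?V > 0 \<Longrightarrow> excess r ?V = 0 \<Longrightarrow> clique_free (Suc r) ?V"
      using N[rule_format, OF adjacency_adjacent[OF G] V] n by blast+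
    have excess: "excess r ?V = (\<Sum>v\<in>?V. (real (degree G v))\<^sup>2) - 2 * (1 - 1 / real r) * real m * real n"
      using excess_eq[OF G] n m by simp
    have "excess r ?V = 0 \<longleftrightarrow> complete_multipartite r G \<and> regular G" if "m > 0"
    proof
      assume zero: "excess r ?V = 0"
      have pos: "arcs ?V > 0" using that m arcs_eq_twice_card_edges[OF G] by simp
      obtain P where "partition_on ?V P" "card P = r"
        "\<And>x y. x \<in> ?V \<Longrightarrow> y \<in> ?V \<Longrightarrow> adjacent G x y \<longleftrightarrow> \<not> (\<exists>A\<in>P. x \<in> A \<and> y \<in> A)"
        "\<And>x y. x \<in> ?V \<Longrightarrow> y \<in> ?V \<Longrightarrow> deg ?V x = deg ?V y"
        using extremal_structure[OF V r(1) ex(2)[OF pos zero] zero pos] by blast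
      then show "complete_multipartite r G \<and> regular G"
        unfolding complete_multipartite_iff[OF G] regular_iff_deg[OF G] by blast
    next
      assume *: "complete_multipartite r G \<and> regular G"
      then obtain P where P: "partition_on ?V P" "card P = r"
        "\<forall>x\<in>?V. \<forall>y\<in>?V. adjacent G x y \<longleftrightarrow> \<not> (\<exists>A\<in>P. x \<in> A \<and> y \<in> A)"
        unfolding complete_multipartite_iff[OF G] by blast
      show "excess r ?V = 0"
        by (rule excess_eq_0_if_balanced[OF V P(1,2) r(2)])
          (use P(3) * regular_iff_deg[OF G] in blast)+
    qed
    moreover have "excess r ?V = 0 \<longleftrightarrow>
        (\<Sum>v\<in>?V. (real (degree G v))\<^sup>2) = 2 * (1 - 1 / real r) * real m * real n"
      unfolding excess by (rule right_minus_eq)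
    moreover have "(\<Sum>v\<in>?V. (real (degree G v))\<^sup>2) \<le> 2 * (1 - 1 / real r) * real m * real n"
      using ex(1) unfolding excess by (simp only: diff_le_0_iff_le)
    ultimately show "(\<Sum>v\<in>?V. (real (degree G v))\<^sup>2) \<le> 2 * (1 - 1 / real r) * real m * real n \<and>
      (m > 0 \<longrightarrow>
        ((\<Sum>v\<in>?V. (real (degree G v))\<^sup>2) = 2 * (1 - 1 / real r) * real m * real n
          \<longleftrightarrow> complete_multipartite r G \<and> regular G))"
      by blast
  qed
qed

end
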